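(* Let $K$, $L$, $q$, $\mathcal{O}_n$, the tree $\mathcal{T}$, the basin $\mathcal{P}$ and the layers $\mathcal{R}_n$ be as in the context, where the basin is chosen according to whether $L/K$ is unramified, ramified or split. For every integer $n\ge 0$ let $$\zeta^P_{\mathcal{O}_n}(s)=\sum_{\substack{I\subseteq \mathcal{O}_n\ \text{principal ideal}\\ \text{of finite index}}}\frac{1}{[\mathcal{O}_n:I]^s},$$ and let $\zeta_{\mathcal{B},\mathcal{O}_n}(X)=\sum_{d\ge 0} r_d X^d$, where $r_d$ is the number of vertices $x\in\mathcal{R}_{h([\mathcal{O}_n])}$ which can be reached from the vertex $[\mathcal{O}_n]$ by a path (walk, not necessarily non-backtracking or geodesic, and not necessarily staying in any layer) of length exactly $d$ in $\mathcal{T}$. Then $$\zeta^P_{\mathcal{O}_n}(s)=\zeta_{\mathcal{B},\mathcal{O}_n}(q^{-s}).$$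
   Context: $K$ is a nonarchimedean local field of characteristic zero with ring of integers $\mathcal{O}_K$, uniformizer $p$, and residue field of cardinality $q$. $L$ is a reduced $K$-algebra of dimension $2$, so $L$ is an unramified quadratic field extension of $K$, a ramified quadratic field extension of $K$, or $L=K\times K$ (the unramified, ramified and split cases). $\mathcal{O}_L$ is the integral closure of $\mathcal{O}_K$ in $L$; fix $\Delta\in\mathcal{O}_L$ with $\mathcal{O}_L=\mathcal{O}_K[\Delta]$ and for $n\ge0$ put $\mathcal{O}_n=\mathcal{O}_K[p^n\Delta]=\{x+yp^n\Delta: x,y\in\mathcal{O}_K\}$. Ideals of finite index in $\mathcal{O}_n$ are exactly those of rank 2 as $\mathcal{O}_K$-modules. $\mathcal{T}$ is the Bruhat–Tits tree of $SL(2,K)$ realized on $L$: its vertices are homothety classes $[\Lambda]$ (under $\Lambda\sim\lambda\Lambda$, $\lambda\in K^*$) of $\mathcal{O}_K$-lattices $\Lambda\subset L$ (free $\mathcal{O}_K$-submodules of rank 2), two vertices being adjacent iff they have representatives with $p\Lambda\subsetneq\Lambda'\subsetneq\Lambda$; $d(\cdot,\cdot)$ is graph distance. The basin $\mathcal{P}$ is: in the unramified case the single vertex $[\mathcal{O}_L]$; in the ramified case the edge with vertices $[\mathcal{O}_L]$ and $[\pi\mathcal{O}_L]$, $\pi$ a uniformizer of $L$; in the split case the apartment with vertices $[\widetilde{\mathcal{O}}_m]$, $m\in\mathbb{Z}$, where $\widetilde{\mathcal{O}}_m=\mathcal{O}_K\times p^m\mathcal{O}_K$. Layers: $\mathcal{P}_0=\mathcal{P}$,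 $\mathcal{P}_n=\{v: d(v,\mathcal{P}_{n-1})\le1\}$ for $n\ge1$, $\mathcal{R}_0=\mathcal{P}$, $\mathcal{R}_n=\mathcal{P}_n\setminus\mathcal{P}_{n-1}$; the height $h(v)$ of a vertex $v$ is the unique $n$ with $v\in\mathcal{R}_n$. *)

theory Defs
  imports "HOL-Analysis.Analysis" "HOL-Computational_Algebra.Polynomial"
begin

definition add_cosets :: "'a::ab_group_add set \<Rightarrow> 'a set \<Rightarrow> 'a set set" where
  "add_cosets A B = A // {(x, y). x \<in> A \<and> y \<in> A \<and> x - y \<in> B}"

definition add_index :: "'a::ab_group_add set \<Rightarrow> 'a set \<Rightarrow> nat" where
  "add_index A B = card (add_cosets A B)"


subsection \<open>The local field\<close>

text \<open>A discrete valuation is a function to the integers that is only meaningful on nonzero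
  elements; its value at \<open>0\<close> (which should be infinity) is never used.\<close>

definition val_ge :: "('k::field \<Rightarrow> int) \<Rightarrow> 'k \<Rightarrow> int \<Rightarrow> bool" where
  "val_ge v x N \<longleftrightarrow> x = 0 \<or> v x \<ge> N"

definition val_ring :: "('k::field \<Rightarrow> int) \<Rightarrow> 'k set" where
  "val_ring v = {x. val_ge v x 0}"

definition val_max_ideal :: "('k::field \<Rightarrow> int) \<Rightarrow> 'k set" where
  "val_max_ideal v = {x. val_ge v x 1}"

definition residue_card :: "('k::field \<Rightarrow> int) \<Rightarrow> nat" where
  "residue_card v = card (add_cosets (val_ring v) (val_max_ideal v))"

definition val_uniformizer :: "('k::field \<Rightarrow> int) \<Rightarrow> 'k \<Rightarrow> bool" where
  "val_uniformizer v p \<longleftrightarrow> p \<noteq> 0 \<and> v p = 1"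

locale nonarch_local_field =
  fixes v :: "'k::field_char_0 \<Rightarrow> int"
  assumes val_mult: "\<And>x y. x \<noteq> 0 \<Longrightarrow> y \<noteq> 0 \<Longrightarrow> v (x * y) = v x + v y"
    and val_add: "\<And>x y. x \<noteq> 0 \<Longrightarrow> y \<noteq> 0 \<Longrightarrow> x + y \<noteq> 0 \<Longrightarrow> min (v x) (v y) \<le> v (x + y)"
    and val_normalized: "\<exists>p. val_uniformizer v p"
    and val_complete: "\<And>X :: nat \<Rightarrow> 'k.
          (\<forall>N. \<exists>M. \<forall>m\<ge>M. \<forall>n\<ge>M. val_ge v (X m - X n) N) \<Longrightarrow>
          (\<exists>x. \<forall>N. \<exists>M. \<forall>n\<ge>M. val_ge v (X n - x) N)"
    and residue_finite: "finite (add_cosets (val_ring v) (val_max_ideal v))"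


subsection \<open>The quadratic algebra and its orders\<close>

locale reduced_quadratic_algebra = vector_space smul
  for smul :: "'k::field \<Rightarrow> 'l::comm_ring_1 \<Rightarrow> 'l" +
  assumes smul_mult: "\<And>a x y. smul a x * y = smul a (x * y)"
    and reduced: "\<And>(x::'l) (n::nat). x ^ n = 0 \<Longrightarrow> x = 0"
    and dim_two: "vector_space.dim smul (UNIV :: 'l set) = 2"

definition poly_at :: "('k::field \<Rightarrow> 'l::comm_ring_1 \<Rightarrow> 'l) \<Rightarrow> 'k poly \<Rightarrow> 'l \<Rightarrow> 'l" where
  "poly_at smul P x = (\<Sum>i\<le>degree P. smul (coeff P i) (x ^ i))"

definition integral_closure ::
    "('k::field \<Rightarrow> int) \<Rightarrow> ('k \<Rightarrow> 'l::comm_ring_1 \<Rightarrow> 'l) \<Rightarrow> 'l set" where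
  "integral_closure v smul =
     {x. \<exists>P. lead_coeff P = 1 \<and> (\<forall>i. coeff P i \<in> val_ring v) \<and> poly_at smul P x = 0}"

definition adjoin ::
    "('k::field \<Rightarrow> int) \<Rightarrow> ('k \<Rightarrow> 'l::comm_ring_1 \<Rightarrow> 'l) \<Rightarrow> 'l \<Rightarrow> 'l set" where
  "adjoin v smul x = {poly_at smul P x | P. \<forall>i. coeff P i \<in> val_ring v}"

definition quad_order ::
    "('k::field \<Rightarrow> int) \<Rightarrow> ('k \<Rightarrow> 'l::comm_ring_1 \<Rightarrow> 'l) \<Rightarrow> 'k \<Rightarrow> 'l \<Rightarrow> nat \<Rightarrow> 'l set" where
  "quad_order v smul p \<Delta> n =
     {smul x 1 + smul (y * p ^ n) \<Delta> | x y. x \<in> val_ring v \<and> y \<in> val_ring v}"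

definition is_uniformizer ::
    "('k::field \<Rightarrow> int) \<Rightarrow> ('k \<Rightarrow> 'l::comm_ring_1 \<Rightarrow> 'l) \<Rightarrow> 'l \<Rightarrow> bool" where
  "is_uniformizer v smul \<pi> \<longleftrightarrow>
     (let OL = integral_closure v smul
      in \<pi> \<in> OL \<and> (\<lambda>x. \<pi> * x) ` OL = {x \<in> OL. \<not> (\<exists>y\<in>OL. x * y = 1)})"

text \<open>Residue extensions of finite fields are separable, so a field extension is unramified iff its
  ramification index is \<open>1\<close>, i.e. iff \<open>p\<close> generates the maximal ideal of the integral closure.\<close>

definition is_unramified ::
    "('k::field \<Rightarrow> int) \<Rightarrow> ('k \<Rightarrow> 'l::comm_ring_1 \<Rightarrow> 'l) \<Rightarrow> 'k \<Rightarrow> bool" where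
  "is_unramified v smul p \<longleftrightarrow>
     (\<forall>x::'l. x \<noteq> 0 \<longrightarrow> (\<exists>y. x * y = 1)) \<and> is_uniformizer v smul (smul p 1)"

definition is_ramified ::
    "('k::field \<Rightarrow> int) \<Rightarrow> ('k \<Rightarrow> 'l::comm_ring_1 \<Rightarrow> 'l) \<Rightarrow> 'k \<Rightarrow> bool" where
  "is_ramified v smul p \<longleftrightarrow>
     (\<forall>x::'l. x \<noteq> 0 \<longrightarrow> (\<exists>y. x * y = 1)) \<and> \<not> is_uniformizer v smul (smul p 1)"

text \<open>Isomorphisms of \<open>K\<close>-algebras from \<open>L\<close> onto \<open>K \<times> K\<close>.\<close>

definition splitting :: "('k::field \<Rightarrow> 'l::comm_ring_1 \<Rightarrow> 'l) \<Rightarrow> ('l \<Rightarrow> 'k \<times> 'k) \<Rightarrow> bool" where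
  "splitting smul \<phi> \<longleftrightarrow> bij \<phi> \<and> \<phi> 1 = (1, 1) \<and>
     (\<forall>x y. \<phi> (x + y) = (fst (\<phi> x) + fst (\<phi> y), snd (\<phi> x) + snd (\<phi> y))) \<and>
     (\<forall>x y. \<phi> (x * y) = (fst (\<phi> x) * fst (\<phi> y), snd (\<phi> x) * snd (\<phi> y))) \<and>
     (\<forall>a x. \<phi> (smul a x) = (a * fst (\<phi> x), a * snd (\<phi> x)))"

definition is_split :: "('k::field \<Rightarrow> 'l::comm_ring_1 \<Rightarrow> 'l) \<Rightarrow> bool" where
  "is_split smul \<longleftrightarrow> (\<exists>\<phi>. splitting smul \<phi>)"


subsection \<open>The Bruhat--Tits tree\<close>

definition is_lattice ::
    "('k::field \<Rightarrow> int) \<Rightarrow> ('k \<Rightarrow> 'l::comm_ring_1 \<Rightarrow> 'l) \<Rightarrow> 'l set \<Rightarrow> bool" where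
  "is_lattice v smul \<Lambda> \<longleftrightarrow> (\<exists>e f.
     (\<forall>x\<in>val_ring v. \<forall>y\<in>val_ring v. smul x e + smul y f = 0 \<longrightarrow> x = 0 \<and> y = 0) \<and>
     \<Lambda> = {smul x e + smul y f | x y. x \<in> val_ring v \<and> y \<in> val_ring v})"

definition homothety_class ::
    "('k::field \<Rightarrow> 'l::comm_ring_1 \<Rightarrow> 'l) \<Rightarrow> 'l set \<Rightarrow> 'l set set" where
  "homothety_class smul \<Lambda> = {smul c ` \<Lambda> | c. c \<noteq> 0}"

definition bt_vertices ::
    "('k::field \<Rightarrow> int) \<Rightarrow> ('k \<Rightarrow> 'l::comm_ring_1 \<Rightarrow> 'l) \<Rightarrow> 'l set set set" where
  "bt_vertices v smul = homothety_class smul ` {\<Lambda>. is_lattice v smul \<Lambda>}"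

definition bt_edges ::
    "('k::field \<Rightarrow> int) \<Rightarrow> ('k \<Rightarrow> 'l::comm_ring_1 \<Rightarrow> 'l) \<Rightarrow> 'k \<Rightarrow> ('l set set \<times> 'l set set) set" where
  "bt_edges v smul p =
     {(x, y). x \<in> bt_vertices v smul \<and> y \<in> bt_vertices v smul \<and>
        (\<exists>\<Lambda>\<in>x. \<exists>\<Lambda>'\<in>y. smul p ` \<Lambda> \<subset> \<Lambda>' \<and> \<Lambda>' \<subset> \<Lambda>)}"

text \<open>\<open>\<pi>\<close> is only used in the ramified case (as a uniformizer of \<open>L\<close>) and \<open>\<phi>\<close> only in the split case
  (as the identification of \<open>L\<close> with \<open>K \<times> K\<close>).\<close>

definition basin ::
    "('k::field \<Rightarrow> int) \<Rightarrow> ('k \<Rightarrow> 'l::comm_ring_1 \<Rightarrow> 'l) \<Rightarrow> 'k \<Rightarrow> 'l \<Rightarrow> ('l \<Rightarrow> 'k \<times> 'k) \<Rightarrow>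
     'l set set set" where
  "basin v smul p \<pi> \<phi> =
     (let OL = integral_closure v smul in
      if is_unramified v smul p then {homothety_class smul OL}
      else if is_ramified v smul p then
        {homothety_class smul OL, homothety_class smul ((\<lambda>x. \<pi> * x) ` OL)}
      else
        {homothety_class smul (\<phi> -` (val_ring v \<times> (\<lambda>x. p powi m * x) ` val_ring v)) | m :: int. True})"


subsection \<open>Distances, layers and heights in a graph with vertex set \<open>V\<close> and edge relation \<open>E\<close>\<close>

definition graph_dist :: "('a \<times> 'a) set \<Rightarrow> 'a \<Rightarrow> 'a \<Rightarrow> nat" where
  "graph_dist E x y = (LEAST d. (x, y) \<in> E ^^ d)"

definition graph_setdist :: "('a \<times> 'a) set \<Rightarrow> 'a \<Rightarrow> 'a set \<Rightarrow> nat" where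
  "graph_setdist E x S = (INF y\<in>S. graph_dist E x y)"

primrec thick :: "'a set \<Rightarrow> ('a \<times> 'a) set \<Rightarrow> 'a set \<Rightarrow> nat \<Rightarrow> 'a set" where
  "thick V E P 0 = P"
| "thick V E P (Suc n) = {x \<in> V. graph_setdist E x (thick V E P n) \<le> 1}"

primrec layer :: "'a set \<Rightarrow> ('a \<times> 'a) set \<Rightarrow> 'a set \<Rightarrow> nat \<Rightarrow> 'a set" where
  "layer V E P 0 = P"
| "layer V E P (Suc n) = thick V E P (Suc n) - thick V E P n"

definition height :: "'a set \<Rightarrow> ('a \<times> 'a) set \<Rightarrow> 'a set \<Rightarrow> 'a \<Rightarrow> nat" where
  "height V E P x = (THE n. x \<in> layer V E P n)"


subsection \<open>The two zeta functions\<close>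

definition fin_principal_ideals :: "'l::comm_ring_1 set \<Rightarrow> 'l set set" where
  "fin_principal_ideals R = {I. (\<exists>a\<in>R. I = (\<lambda>x. a * x) ` R) \<and> finite (add_cosets R I)}"

definition zeta_P_term :: "'l::comm_ring_1 set \<Rightarrow> complex \<Rightarrow> 'l set \<Rightarrow> complex" where
  "zeta_P_term R s I = 1 / of_nat (add_index R I) powr s"

definition zeta_P :: "'l::comm_ring_1 set \<Rightarrow> complex \<Rightarrow> complex" where
  "zeta_P R s = (\<Sum>\<^sub>\<infinity>I\<in>fin_principal_ideals R. zeta_P_term R s I)"

text \<open>Walks of length \<open>d\<close> from \<open>x\<close> to \<open>y\<close> exist iff \<open>(x, y) \<in> E ^^ d\<close>.\<close>

definition reach_set :: "'a set \<Rightarrow> ('a \<times> 'a) set \<Rightarrow> 'a set \<Rightarrow> 'a \<Rightarrow> nat \<Rightarrow> 'a set" where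
  "reach_set V E P x d = {y \<in> layer V E P (height V E P x). (x, y) \<in> E ^^ d}"

definition reach_count :: "'a set \<Rightarrow> ('a \<times> 'a) set \<Rightarrow> 'a set \<Rightarrow> 'a \<Rightarrow> nat \<Rightarrow> nat" where
  "reach_count V E P x d = card (reach_set V E P x d)"

definition zeta_B_term ::
    "'a set \<Rightarrow> ('a \<times> 'a) set \<Rightarrow> 'a set \<Rightarrow> 'a \<Rightarrow> complex \<Rightarrow> nat \<Rightarrow> complex" where
  "zeta_B_term V E P x X d = of_nat (reach_count V E P x d) * X ^ d"

definition zeta_B :: "'a set \<Rightarrow> ('a \<times> 'a) set \<Rightarrow> 'a set \<Rightarrow> 'a \<Rightarrow> complex \<Rightarrow> complex" where
  "zeta_B V E P x X = (\<Sum>d. zeta_B_term V E P x X d)"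

end

theory Submission
  imports Defs
begin

text \<open>
  Put \<open>O\<^sub>n = O\<^sub>K + O\<^sub>K p\<^sup>n \<Delta>\<close>. Every lattice in \<open>L\<close> has the form \<open>z O\<^sub>m\<close> with \<open>z\<close> invertible, because its norm form
  represents a generator of its content. The number \<open>m\<close> changes by at most one along an edge, it can be
  lowered by moving from \<open>z O\<^sub>m\<close> to \<open>z O\<^sub>m\<^sub>-\<^sub>1\<close>, and the vertices with \<open>m = 0\<close> form the basin; hence \<open>m\<close> is
  the height and the layer of \<open>[O\<^sub>n]\<close> consists of the vertices \<open>[a O\<^sub>n]\<close>. Walks of length \<open>d\<close> starting at \<open>[\<Lambda>]\<close>
  lift to chains of sublattices of index \<open>q\<close>, so their endpoints correspond bijectively to the
  sublattices of \<open>\<Lambda>\<close> of index \<open>q\<^sup>d\<close>. Consequently the principal ideals of index \<open>q\<^sup>d\<close> in \<open>O\<^sub>n\<close> are counted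
  by \<open>r\<^sub>d\<close>. Each vertex \<open>[a O\<^sub>n]\<close> lies at bounded distance from the basin vertex \<open>[a O\<^sub>L]\<close>, so \<open>r\<^sub>d\<close> grows at
  most linearly and both series converge for \<open>Re s > 0\<close>.
\<close>

subsection \<open>Cosets and valuations\<close>

text \<open>A vertex of the tree has about q^d vertices at distance d, so counting all endpoints of
  walks would give convergence only for Re s > 1; it is the restriction to one layer that leaves
  linear growth. Walks may backtrack: going along an edge and back multiplies the lifted lattice by
  p, at the cost of index q^2. Hence ideals inside p \<Lambda> are counted on the same footing as
  primitive ones. Ends of two lifts of equal length have equal index, so homothetic ends coincide;
  this is why walks of length exactly d, and not distances, count ideals. The three types of L are
  treated uniformly as far as possible: m is read off from the condition p^m \<Delta> \<Lambda> <=
  \<Lambda>, which depends only on the homothety class and passes to a neighbour at the cost of one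
  factor p. Only the classes with m = 0 have to be compared with the three descriptions of the
  basin, and those descriptions are used once more for the growth estimate.\<close>

lemma add_cosets_eq_image: "add_cosets A B = (\<lambda>x. {y\<in>A. x - y \<in> B}) ` A"
  unfolding add_cosets_def quotient_def by auto

section \<open>Subgroups, coset representatives and indices\<close>

definition add_subgroup :: "'a::ab_group_add set \<Rightarrow> bool" where
  "add_subgroup H \<longleftrightarrow> 0 \<in> H \<and> (\<forall>x\<in>H. \<forall>y\<in>H. x - y \<in> H)"

lemma add_subgroupD:
  assumes "add_subgroup H"
  shows "0 \<in> H" "x \<in> H \<Longrightarrow> y \<in> H \<Longrightarrow> x - y \<in> H" "x \<in> H \<Longrightarrow> - x \<in> H"
    "x \<in> H \<Longrightarrow> y \<in> H \<Longrightarrow> x + y \<in> H"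
proof -
  have *: "0 \<in> H" "\<And>x y. x \<in> H \<Longrightarrow> y \<in> H \<Longrightarrow> x - y \<in> H"
    using assms by (auto simp: add_subgroup_def)
  have **: "- x \<in> H" if "x \<in> H" for x using *(2)[OF *(1) that] by simp
  show "0 \<in> H" "x \<in> H \<Longrightarrow> y \<in> H \<Longrightarrow> x - y \<in> H" "x \<in> H \<Longrightarrow> - x \<in> H" by (fact * **)+
  show "x \<in> H \<Longrightarrow> y \<in> H \<Longrightarrow> x + y \<in> H" using *(2)[OF _ **, of x y] by simp
qed

text \<open>Finiteness is not built in, so that it can itself be transferred along bijections
  between representatives and cosets.\<close>

definition transversal :: "'a::ab_group_add set \<Rightarrow> 'a set \<Rightarrow> 'a set \<Rightarrow> bool" where
  "transversal A B R \<longleftrightarrow> R \<subseteq> A \<and> (\<forall>x\<in>A. \<exists>!r. r \<in> R \<and> x - r \<in> B)"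

lemma transversal_bij:
  assumes "add_subgroup A" "add_subgroup B" "B \<subseteq> A" "transversal A B R"
  shows "bij_betw (\<lambda>x. {y\<in>A. x - y \<in> B}) R (add_cosets A B)"
proof -
  have R: "R \<subseteq> A" "\<And>x. x \<in> A \<Longrightarrow> \<exists>!r. r \<in> R \<and> x - r \<in> B"
    using assms(4) by (auto simp: transversal_def)
  note B = add_subgroupD[OF assms(2)]
  have "inj_on (\<lambda>x. {y\<in>A. x - y \<in> B}) R"
  proof (rule inj_onI)
    fix x y assume xy: "x \<in> R" "y \<in> R" and eq: "{z\<in>A. x - z \<in> B} = {z\<in>A. y - z \<in> B}"
    have "x - y \<in> B" using eq xy R(1) B(1) by auto
    moreover have "x - x \<in> B" using B(1) by simp
    ultimately show "x = y" using R(2)[of x] xy R(1) by blast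
  qed
  moreover have "(\<lambda>x. {y\<in>A. x - y \<in> B}) ` A \<subseteq> (\<lambda>x. {y\<in>A. x - y \<in> B}) ` R"
  proof (rule image_subsetI)
    fix x assume "x \<in> A"
    then obtain r where r: "r \<in> R" "x - r \<in> B" using R(2) by blast
    have "x - y \<in> B \<longleftrightarrow> r - y \<in> B" for y
      using B(2)[of "x - y" "x - r"] B(4)[of "r - y" "x - r"] r by auto
    then show "{y\<in>A. x - y \<in> B} \<in> (\<lambda>x. {y\<in>A. x - y \<in> B}) ` R" using r by auto
  qed
  ultimately show ?thesis using R(1) unfolding bij_betw_def add_cosets_eq_image by blast
qed

lemma transversal_exists:
  assumes "add_subgroup A" "add_subgroup B" "B \<subseteq> A"
  obtains R where "transversal A B R"
proof
  note B = add_subgroupD[OF assms(2)]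
  define c where "c x = (SOME y. y \<in> A \<and> x - y \<in> B)" for x
  have c: "c x \<in> A \<and> x - c x \<in> B" if "x \<in> A" for x
    unfolding c_def by (rule someI[of _ x]) (use that B(1) in auto)
  have ceq: "c x = c y" if "x - y \<in> B" for x y
  proof -
    have "x - z \<in> B \<longleftrightarrow> y - z \<in> B" for z
      using B(2)[of "x - z" "x - y"] B(4)[of "y - z" "x - y"] that by auto
    then show ?thesis by (simp add: c_def)
  qed
  show "transversal A B (c ` A)"
    unfolding transversal_def
  proof (intro conjI ballI)
    show "c ` A \<subseteq> A" using c by auto
    fix x assume x: "x \<in> A"
    show "\<exists>!r. r \<in> c ` A \<and> x - r \<in> B"
    proof (rule ex1I[of _ "c x"])
      show "c x \<in> c ` A \<and> x - c x \<in> B" using c x by auto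
      fix r assume r: "r \<in> c ` A \<and> x - r \<in> B"
      then obtain a where a: "a \<in> A" "r = c a" by auto
      have "x - a \<in> B" using B(2)[of "x - c a" "a - c a"] c a r by auto
      then show "r = c x" using ceq a by simp
    qed
  qed
qed

text \<open>Sums of a representative of A/B and one of B/C represent A/C. Finiteness is tracked
  separately because \<open>card\<close> gives an infinite index the value 0.\<close>

lemma add_cosets_tower:
  assumes "add_subgroup A" "add_subgroup B" "add_subgroup C" "B \<subseteq> A" "C \<subseteq> B"
  shows "add_index A C = add_index A B * add_index B C"
    and "finite (add_cosets A C) \<longleftrightarrow> finite (add_cosets A B) \<and> finite (add_cosets B C)"
proof -
  obtain R where R: "transversal A B R" using transversal_exists assms by blast
  obtain S where S: "transversal B C S" using transversal_exists assms by blast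
  note A = add_subgroupD[OF assms(1)] note B = add_subgroupD[OF assms(2)]
  note C = add_subgroupD[OF assms(3)]
  let ?T = "(\<lambda>(r, s). r + s) ` (R \<times> S)"
  have sub: "R \<subseteq> A" "S \<subseteq> B" using R S by (auto simp: transversal_def)
  have Ru: "r = r'" if "r \<in> R" "r' \<in> R" "x - r \<in> B" "x - r' \<in> B" "x \<in> A" for r r' x
    using R that by (auto simp: transversal_def)
  have Su: "r = r'" if "r \<in> S" "r' \<in> S" "x - r \<in> C" "x - r' \<in> C" "x \<in> B" for r r' x
    using S that by (auto simp: transversal_def)
  have uniq: "r = r' \<and> s = s'"
    if "r \<in> R" "r' \<in> R" "s \<in> S" "s' \<in> S" "x - (r + s) \<in> C" "x - (r' + s') \<in> C" "x \<in> A"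
    for r r' s s' x
  proof -
    have 1: "x - r \<in> B" using B(4)[of "x - (r + s)" s] that assms(5) sub by (auto simp: algebra_simps)
    have 2: "x - r' \<in> B"
      using B(4)[of "x - (r' + s')" s'] that assms(5) sub by (auto simp: algebra_simps)
    have r: "r = r'" using Ru 1 2 that by blast
    have "s = s'" using Su[of s s' "x - r"] that 1 r by (auto simp: algebra_simps)
    with r show ?thesis by simp
  qed
  have inj: "inj_on (\<lambda>(r, s). r + s) (R \<times> S)"
  proof (rule inj_onI, clarify)
    fix r s r' s' assume h: "r \<in> R" "s \<in> S" "r' \<in> R" "s' \<in> S" "r + s = r' + s'"
    show "r = r' \<and> s = s'"
      by (rule uniq[of r r' s s' "r + s"]) (use h sub assms(4) C(1) A(4)[of r s] in auto)
  qed
  have T: "transversal A C ?T"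
    unfolding transversal_def
  proof (intro conjI ballI)
    show "?T \<subseteq> A" using sub assms(4) by (auto intro!: A(4))
    fix x assume x: "x \<in> A"
    obtain r where r: "r \<in> R" "x - r \<in> B" using R x by (auto simp: transversal_def)
    obtain s where s: "s \<in> S" "x - r - s \<in> C" using S r by (auto simp: transversal_def)
    show "\<exists>!u. u \<in> ?T \<and> x - u \<in> C"
    proof (rule ex1I[of _ "r + s"])
      show "r + s \<in> ?T \<and> x - (r + s) \<in> C" using r s by (auto simp: algebra_simps)
      fix u assume u: "u \<in> ?T \<and> x - u \<in> C"
      then obtain r' s' where h: "r' \<in> R" "s' \<in> S" "u = r' + s'" by auto
      show "u = r + s" using uniq[of r r' s s' x] r s h u x by (auto simp: algebra_simps)
    qed
  qed
  have CA: "C \<subseteq> A" using assms by auto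
  note b1 = transversal_bij[OF assms(1,3) CA T]
  note b2 = transversal_bij[OF assms(1,2,4) R]
  note b3 = transversal_bij[OF assms(2,3,5) S]
  have "card ?T = card R * card S" using card_image[OF inj] by (simp add: card_cartesian_product)
  then show "add_index A C = add_index A B * add_index B C"
    unfolding add_index_def using bij_betw_same_card[OF b1] bij_betw_same_card[OF b2]
      bij_betw_same_card[OF b3] by simp
  have "finite ?T \<longleftrightarrow> finite (R \<times> S)" using inj finite_image_iff by blast
  moreover have "R \<noteq> {}" using R A(1) by (auto simp: transversal_def)
  moreover have "S \<noteq> {}" using S B(1) by (auto simp: transversal_def)
  ultimately have "finite ?T \<longleftrightarrow> finite R \<and> finite S" by (auto simp: finite_cartesian_product_iff)
  then show "finite (add_cosets A C) \<longleftrightarrow> finite (add_cosets A B) \<and> finite (add_cosets B C)"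
    using bij_betw_finite[OF b1] bij_betw_finite[OF b2] bij_betw_finite[OF b3] by simp
qed

lemma add_index_eq_1_imp_eq:
  assumes "add_subgroup A" "add_subgroup B" "B \<subseteq> A" "add_index A B = 1"
  shows "A = B"
proof -
  note B = add_subgroupD[OF assms(2)]
  obtain X where X: "add_cosets A B = {X}"
    using assms(4) unfolding add_index_def by (auto simp: card_1_singleton_iff)
  have "x \<in> B" if "x \<in> A" for x
  proof -
    have "0 \<in> A" using add_subgroupD(1)[OF assms(1)] .
    then have "{y\<in>A. x - y \<in> B} = {y\<in>A. 0 - y \<in> B}"
      using X that imageI[of x A "\<lambda>x. {y\<in>A. x - y \<in> B}"]
        imageI[of 0 A "\<lambda>x. {y\<in>A. x - y \<in> B}"]
      unfolding add_cosets_eq_image by (simp del: image_eqI)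
    moreover have "x \<in> {y\<in>A. x - y \<in> B}" using that B(1) by simp
    ultimately have "- x \<in> B" by auto
    then show ?thesis using B(3)[of "- x"] by simp
  qed
  then show ?thesis using assms(3) by auto
qed

text \<open>An intermediate subgroup is a union of cosets of B. The bound is crude, but it depends
  on the index alone, which is what the growth estimate needs.\<close>

lemma subgroups_between_bound:
  assumes "add_subgroup A" "add_subgroup B" "B \<subseteq> A" "finite (add_cosets A B)"
  shows "finite {C. add_subgroup C \<and> B \<subseteq> C \<and> C \<subseteq> A}"
    "card {C. add_subgroup C \<and> B \<subseteq> C \<and> C \<subseteq> A} \<le> 2 ^ add_index A B"
proof -
  have "C \<in> Union ` Pow (add_cosets A B)" if "add_subgroup C" "B \<subseteq> C" "C \<subseteq> A" for C
  proof
    note B = add_subgroupD[OF assms(2)]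
    note C = add_subgroupD[OF that(1)]
    let ?F = "(\<lambda>x. {y\<in>A. x - y \<in> B}) ` C"
    show "?F \<in> Pow (add_cosets A B)" using that(3) by (auto simp: add_cosets_eq_image)
    show "C = \<Union>?F"
    proof
      show "C \<subseteq> \<Union>?F" using that(3) B(1) by auto
      have "y \<in> C" if "x \<in> C" "x - y \<in> B" for x y
        using C(2)[of x "x - y"] that \<open>B \<subseteq> C\<close> by auto
      then show "\<Union>?F \<subseteq> C" by auto
    qed
  qed
  then have sub: "{C. add_subgroup C \<and> B \<subseteq> C \<and> C \<subseteq> A} \<subseteq> Union ` Pow (add_cosets A B)" by auto
  then show "finite {C. add_subgroup C \<and> B \<subseteq> C \<and> C \<subseteq> A}"
    using assms(4) by (meson finite_Pow_iff finite_imageI finite_subset)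
  have "card {C. add_subgroup C \<and> B \<subseteq> C \<and> C \<subseteq> A} \<le> card (Union ` Pow (add_cosets A B))"
    using sub assms(4) by (intro card_mono) auto
  also have "\<dots> \<le> card (Pow (add_cosets A B))" using assms(4) by (intro card_image_le) auto
  also have "\<dots> = 2 ^ add_index A B" using assms(4) by (simp add: card_Pow add_index_def)
  finally show "card {C. add_subgroup C \<and> B \<subseteq> C \<and> C \<subseteq> A} \<le> 2 ^ add_index A B" .
qed

section \<open>Arithmetic in the valuation ring\<close>

context nonarch_local_field
begin

abbreviation O\<^sub>K where "O\<^sub>K \<equiv> val_ring v"

lemma val_one [simp]: "v 1 = 0"
  using val_mult[of 1 1] by simp

lemma val_minus_one: "v (-1) = 0"
  using val_mult[of "-1" "-1"] by simp

lemma val_uminus [simp]: "v (- x) = v x"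
  using val_mult[of "-1" x] val_minus_one by (cases "x = 0") auto

lemma val_inverse: "x \<noteq> 0 \<Longrightarrow> v (inverse x) = - v x"
  using val_mult[of x "inverse x"] by simp

lemma val_power: "x \<noteq> 0 \<Longrightarrow> v (x ^ k) = int k * v x"
  by (induction k) (auto simp: val_mult algebra_simps)

lemma val_powi: "x \<noteq> 0 \<Longrightarrow> v (x powi k) = k * v x"
  by (auto simp: power_int_def val_power val_inverse)

lemma val_ge_add: "val_ge v x k \<Longrightarrow> val_ge v y k \<Longrightarrow> val_ge v (x + y) k"
  using val_add[of x y] unfolding val_ge_def by force

lemma val_ge_mult: "val_ge v x k \<Longrightarrow> val_ge v y l \<Longrightarrow> val_ge v (x * y) (k + l)"
  using val_mult[of x y] unfolding val_ge_def by force

lemma val_ge_uminus: "val_ge v x k \<Longrightarrow> val_ge v (- x) k"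
  unfolding val_ge_def by simp

lemma val_ring_iff: "x \<in> O\<^sub>K \<longleftrightarrow> x = 0 \<or> v x \<ge> 0"
  by (simp add: val_ring_def val_ge_def)

lemma val_ring_closed [simp]:
  "0 \<in> O\<^sub>K" "1 \<in> O\<^sub>K" "x \<in> O\<^sub>K \<Longrightarrow> y \<in> O\<^sub>K \<Longrightarrow> x + y \<in> O\<^sub>K"
  "x \<in> O\<^sub>K \<Longrightarrow> y \<in> O\<^sub>K \<Longrightarrow> x * y \<in> O\<^sub>K" "x \<in> O\<^sub>K \<Longrightarrow> - x \<in> O\<^sub>K"
  "x \<in> O\<^sub>K \<Longrightarrow> y \<in> O\<^sub>K \<Longrightarrow> x - y \<in> O\<^sub>K" "x \<in> O\<^sub>K \<Longrightarrow> x ^ k \<in> O\<^sub>K"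
proof -
  show *: "0 \<in> O\<^sub>K" "1 \<in> O\<^sub>K" "\<And>x y. x \<in> O\<^sub>K \<Longrightarrow> y \<in> O\<^sub>K \<Longrightarrow> x + y \<in> O\<^sub>K"
    "\<And>x y. x \<in> O\<^sub>K \<Longrightarrow> y \<in> O\<^sub>K \<Longrightarrow> x * y \<in> O\<^sub>K" "\<And>x. x \<in> O\<^sub>K \<Longrightarrow> - x \<in> O\<^sub>K"
    using val_ge_add val_ge_mult[of _ 0 _ 0] val_ge_uminus
    by (auto simp: val_ring_def) (auto simp: val_ge_def)
  show "x \<in> O\<^sub>K \<Longrightarrow> y \<in> O\<^sub>K \<Longrightarrow> x - y \<in> O\<^sub>K" using *(3)[OF _ *(5), of x y] by simp
  show "x \<in> O\<^sub>K \<Longrightarrow> x ^ k \<in> O\<^sub>K" by (induction k) (auto simp: *)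
qed

lemma val_ring_unit: "x \<noteq> 0 \<Longrightarrow> v x = 0 \<Longrightarrow> x \<in> O\<^sub>K \<and> inverse x \<in> O\<^sub>K"
  by (simp add: val_ring_iff val_inverse)

lemma val_ring_divide: "y \<noteq> 0 \<Longrightarrow> x = 0 \<or> v y \<le> v x \<Longrightarrow> x / y \<in> O\<^sub>K"
  by (cases "x = 0") (auto simp: val_ring_iff divide_inverse val_mult val_inverse)

text \<open>If \<open>v c < 0\<close>, dividing the monic equation of degree \<open>d\<close> by \<open>c ^ d\<close> puts \<open>1\<close> into the maximal ideal.\<close>

lemma val_ring_integrally_closed:
  assumes "lead_coeff P = 1" "\<forall>i. coeff P i \<in> O\<^sub>K" "poly P c = 0"
  shows "c \<in> O\<^sub>K"
proof (rule ccontr)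
  assume "c \<notin> O\<^sub>K"
  then have c: "c \<noteq> 0" "v c < 0" by (auto simp: val_ring_iff)
  define d where "d = degree P"
  define u where "u = inverse c"
  have u: "u \<noteq> 0" "v u \<ge> 1" using c by (auto simp: u_def val_inverse)
  have "0 = u ^ d * (\<Sum>i\<le>d. coeff P i * c ^ i)" using assms(3) by (simp add: poly_altdef d_def)
  also have "\<dots> = (\<Sum>i\<le>d. coeff P i * u ^ (d - i))"
    unfolding sum_distrib_left
  proof (rule sum.cong)
    fix i assume "i \<in> {..d}"
    then have "u ^ d = u ^ (d - i) * u ^ i" by (simp flip: power_add)
    moreover have "u ^ i * c ^ i = 1" using c by (simp add: u_def flip: power_mult_distrib)
    ultimately show "u ^ d * (coeff P i * c ^ i) = coeff P i * u ^ (d - i)"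
      by (metis (no_types, lifting) ab_semigroup_mult_class.mult_ac(1) mult.commute mult.right_neutral)
  qed simp
  also have "\<dots> = 1 + (\<Sum>i<d. coeff P i * u ^ (d - i))"
    using assms(1) by (simp add: d_def lessThan_Suc_atMost[symmetric])
  finally have eq: "-1 = (\<Sum>i<d. coeff P i * u ^ (d - i))" by (metis add_eq_0_iff)
  have "val_ge v (\<Sum>i\<in>S. coeff P i * u ^ (d - i)) 1" if "finite S" "S \<subseteq> {..<d}" for S
    using that
  proof (induction S rule: finite_induct)
    case empty then show ?case by (simp add: val_ge_def)
  next
    case (insert i S)
    have "int (d - i) * v u \<ge> 1 * 1" using insert u by (intro mult_mono) auto
    then have "val_ge v (u ^ (d - i)) 1" using u by (simp add: val_ge_def val_power del: of_nat_diff)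
    then have "val_ge v (coeff P i * u ^ (d - i)) (0 + 1)"
      using assms(2) by (intro val_ge_mult) (auto simp: val_ring_def)
    then show ?case using insert by (simp add: val_ge_add)
  qed
  from this[of "{..<d}"] have "val_ge v (-1) 1" by (simp flip: eq)
  then show False by (simp add: val_ge_def)
qed

text \<open>The cosets of 0 and 1 differ. The bound makes q^d injective in d, so that an index
  determines the length of a chain.\<close>

lemma residue_card_ge_2: "residue_card v \<ge> 2"
proof -
  let ?c = "\<lambda>x. {y\<in>O\<^sub>K. x - y \<in> val_max_ideal v}"
  have "1 \<in> ?c 1" "1 \<notin> ?c 0" by (auto simp: val_max_ideal_def val_ge_def)
  then have "card {?c 0, ?c 1} = 2" by (subst card_2_iff) blast
  moreover have "{?c 0, ?c 1} \<subseteq> add_cosets O\<^sub>K (val_max_ideal v)"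
    unfolding add_cosets_eq_image using val_ring_closed(1,2) by blast
  ultimately show ?thesis
    unfolding residue_card_def using card_mono[OF residue_finite, of "{?c 0, ?c 1}"] by simp
qed

end

subsection \<open>Lattices in a quadratic algebra\<close>

locale local_quadratic_algebra =
  nonarch_local_field v + reduced_quadratic_algebra smul
  for v :: "'k::field_char_0 \<Rightarrow> int" and smul :: "'k \<Rightarrow> 'l::comm_ring_1 \<Rightarrow> 'l" +
  fixes p :: 'k
  assumes uniformizer: "val_uniformizer v p"
begin

lemma p_nonzero [simp]: "p \<noteq> 0" and val_p [simp]: "v p = 1"
  using uniformizer by (auto simp: val_uniformizer_def)

lemma p_in_val_ring [simp]: "p \<in> O\<^sub>K"
  by (simp add: val_ring_iff)

lemma val_p_power [simp]: "v (p ^ k) = int k"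
  by (simp add: val_power)

lemma val_ring_nonunit: "x \<in> O\<^sub>K \<Longrightarrow> \<not> (x \<noteq> 0 \<and> v x = 0) \<Longrightarrow> \<exists>y\<in>O\<^sub>K. x = p * y"
  using val_ring_divide[of p x] by (intro bexI[of _ "x / p"]) (auto simp: val_ring_iff)

lemma val_max_ideal_eq: "val_max_ideal v = (*) p ` O\<^sub>K"
proof
  show "val_max_ideal v \<subseteq> (*) p ` O\<^sub>K"
  proof
    fix x assume "x \<in> val_max_ideal v"
    then have "x = 0 \<or> v x \<ge> 1" by (simp add: val_max_ideal_def val_ge_def)
    then show "x \<in> (*) p ` O\<^sub>K" using val_ring_nonunit[of x] by (auto simp: val_ring_iff)
  qed
  show "(*) p ` O\<^sub>K \<subseteq> val_max_ideal v"
  proof (rule image_subsetI)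
    fix x assume "x \<in> O\<^sub>K"
    then show "p * x \<in> val_max_ideal v"
      by (cases "x = 0") (auto simp: val_max_ideal_def val_ge_def val_ring_iff val_mult)
  qed
qed

lemma val_ring_scale: "\<exists>k. \<forall>l\<ge>k. p ^ l * x \<in> O\<^sub>K"
proof (cases "x = 0")
  case False
  then show ?thesis by (intro exI[of _ "nat (- v x)"]) (auto simp: val_ring_iff val_mult)
qed auto

text \<open>The structure map from K to L; it turns scalar multiplication into multiplication in the
  ring L, where ring normalization applies.\<close>

definition emb :: "'k \<Rightarrow> 'l" where "emb x = smul x 1"

lemma smul_eq: "smul x y = emb x * y"
  by (simp add: emb_def smul_mult)

lemma emb_hom [simp]: "emb 0 = 0" "emb 1 = 1" "emb (x + y) = emb x + emb y" "emb (- x) = - emb x"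
  "emb (x - y) = emb x - emb y" "emb (x * y) = emb x * emb y" "emb (x ^ k) = emb x ^ k"
proof -
  show *: "emb 0 = 0" "emb 1 = 1" "emb (x + y) = emb x + emb y" "emb (- x) = - emb x"
    "emb (x - y) = emb x - emb y" "\<And>x y. emb (x * y) = emb x * emb y"
    by (auto simp: emb_def scale_left_distrib scale_left_diff_distrib smul_mult)
  show "emb (x ^ k) = emb x ^ k" by (induction k) (auto simp: *)
qed

lemma emb_inverse: "x \<noteq> 0 \<Longrightarrow> emb x * emb (inverse x) = 1"
  by (metis emb_hom(2) emb_hom(6) right_inverse)

lemma emb_cancel: "c \<noteq> 0 \<Longrightarrow> emb c * x = emb c * y \<Longrightarrow> x = y"
  by (metis emb_inverse mult.assoc mult.commute mult_1)

lemma emb_eq_0_iff [simp]: "emb x = 0 \<longleftrightarrow> x = 0"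
  using emb_inverse[of x] by (cases "x = 0") auto

section \<open>Pairs of basis vectors and the lattices they span\<close>

definition indep :: "'l \<Rightarrow> 'l \<Rightarrow> bool" where
  "indep e f \<longleftrightarrow> (\<forall>x y. emb x * e + emb y * f = 0 \<longrightarrow> x = 0 \<and> y = 0)"

definition lat :: "'l \<Rightarrow> 'l \<Rightarrow> 'l set" where
  "lat e f = {emb x * e + emb y * f | x y. x \<in> O\<^sub>K \<and> y \<in> O\<^sub>K}"

lemma indepD: "indep e f \<Longrightarrow> emb x * e + emb y * f = 0 \<Longrightarrow> x = 0 \<and> y = 0"
  by (auto simp: indep_def)

lemma indep_unique:
  assumes "indep e f" "emb x * e + emb y * f = emb x' * e + emb y' * f"
  shows "x = x' \<and> y = y'"
  using indepD[OF assms(1), of "x - x'" "y - y'"] assms(2) by (simp add: algebra_simps)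

lemma indep_commute: "indep e f \<longleftrightarrow> indep f e"
proof -
  have "indep f e" if "indep e f" for e f
    unfolding indep_def
  proof (intro allI impI)
    fix x y assume "emb x * f + emb y * e = 0"
    then have "emb y * e + emb x * f = 0" by (simp add: add.commute)
    then show "x = 0 \<and> y = 0" using indepD[OF that] by blast
  qed
  then show ?thesis by blast
qed

lemma lat_commute: "lat e f = lat f e"
proof -
  have "lat e f \<subseteq> lat f e" for e f
    unfolding lat_def by (auto intro: add.commute)
  then show ?thesis by blast
qed

lemma dim_two_bound: "independent S \<Longrightarrow> finite S \<and> card S \<le> 2"
proof -
  assume S: "independent S"
  obtain B where B: "independent B" "UNIV \<subseteq> span B" "card B = dim UNIV"
    using basis_exists[of UNIV] by metis
  have "finite B" using B(3) dim_two by (intro card_ge_0_finite) simp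
  then show ?thesis using independent_span_bound[OF _ S, of B] B dim_two by auto
qed

text \<open>The inequality is needed because {e, e} collapses to a singleton, which may well be
  independent as a set.\<close>

lemma indep_iff_independent: "indep e f \<longleftrightarrow> e \<noteq> f \<and> independent {e, f}"
proof -
  have "\<not> indep e f \<longleftrightarrow> f = 0 \<or> (\<exists>k. e = emb k * f)"
  proof
    assume "\<not> indep e f"
    then obtain x y where h: "emb x * e + emb y * f = 0" "x \<noteq> 0 \<or> y \<noteq> 0"
      by (auto simp: indep_def)
    show "f = 0 \<or> (\<exists>k. e = emb k * f)"
    proof (cases "x = 0")
      case True
      then show ?thesis using h emb_cancel[of y f 0] by simp
    next
      case False
      have "emb x * e = emb x * (emb (- y / x) * f)"
        using h False by (simp add: eq_neg_iff_add_eq_0 flip: mult.assoc emb_hom(6))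
      then show ?thesis using emb_cancel[OF False] by blast
    qed
  next
    assume "f = 0 \<or> (\<exists>k. e = emb k * f)"
    then show "\<not> indep e f"
    proof
      assume "f = 0"
      then show ?thesis using indepD[of e f 0 1] by auto
    next
      assume "\<exists>k. e = emb k * f"
      then obtain k where "e = emb k * f" ..
      then show ?thesis using indepD[of e f 1 "- k"] by auto
    qed
  qed
  moreover have "e \<noteq> f \<and> independent {e, f} \<longleftrightarrow> \<not> (f = 0 \<or> (\<exists>k. e = emb k * f))"
  proof (cases "e = f")
    case True
    then have "e = emb 1 * f" by simp
    then show ?thesis using True by blast
  next
    case False
    then show ?thesis
      by (auto simp: independent_insert span_breakdown_eq span_empty smul_eq dependent_single)
  qed
  ultimately show ?thesis by blast
qed

lemma indep_span:
  assumes "indep e f"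
  obtains x y where "z = emb x * e + emb y * f"
proof -
  have "z \<in> span {e, f}"
  proof (rule ccontr)
    assume z: "z \<notin> span {e, f}"
    then have "independent {z, e, f}"
      using assms independent_insert[of z "{e, f}"] by (auto simp: indep_iff_independent)
    then have "card {z, e, f} \<le> 2" using dim_two_bound by blast
    moreover have "z \<noteq> e" "z \<noteq> f" using z span_base by blast+
    ultimately show False using assms by (auto simp: indep_iff_independent)
  qed
  then obtain x y where "z - emb x * e - emb y * f = 0"
    by (auto simp: span_breakdown_eq span_empty smul_eq)
  then have "z = emb x * e + emb y * f" by (simp add: algebra_simps)
  then show ?thesis by (rule that)
qed

text \<open>A relation over K becomes one over \<open>O\<^sub>K\<close> after multiplication by a
  power of p, so the two notions of independence agree.\<close>

lemma is_lattice_iff: "is_lattice v smul \<Lambda> \<longleftrightarrow> (\<exists>e f. indep e f \<and> \<Lambda> = lat e f)"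
proof -
  have "(\<forall>x\<in>O\<^sub>K. \<forall>y\<in>O\<^sub>K. smul x e + smul y f = 0 \<longrightarrow> x = 0 \<and> y = 0) \<longleftrightarrow> indep e f" for e f
  proof
    assume h: "\<forall>x\<in>O\<^sub>K. \<forall>y\<in>O\<^sub>K. smul x e + smul y f = 0 \<longrightarrow> x = 0 \<and> y = 0"
    show "indep e f" unfolding indep_def
    proof (intro allI impI)
      fix x y assume eq: "emb x * e + emb y * f = 0"
      obtain k l where k: "\<forall>i\<ge>k. p ^ i * x \<in> O\<^sub>K" and l: "\<forall>i\<ge>l. p ^ i * y \<in> O\<^sub>K"
        using val_ring_scale by metis
      define m where "m = max k l"
      have "smul (p ^ m * x) e + smul (p ^ m * y) f = emb (p ^ m) * (emb x * e + emb y * f)"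
        by (simp add: smul_eq algebra_simps)
      then have "smul (p ^ m * x) e + smul (p ^ m * y) f = 0" using eq by simp
      moreover have "p ^ m * x \<in> O\<^sub>K" "p ^ m * y \<in> O\<^sub>K" using k l by (simp_all add: m_def)
      ultimately have "p ^ m * x = 0 \<and> p ^ m * y = 0" using h by blast
      then show "x = 0 \<and> y = 0" by simp
    qed
  qed (auto simp: indep_def smul_eq)
  then show ?thesis by (auto simp: is_lattice_def lat_def smul_eq)
qed

lemma lat_mem: "x \<in> O\<^sub>K \<Longrightarrow> y \<in> O\<^sub>K \<Longrightarrow> emb x * e + emb y * f \<in> lat e f"
  by (auto simp: lat_def)

lemma lat_basis: "e \<in> lat e f" "f \<in> lat e f"
  using lat_mem[of 1 0 e f] lat_mem[of 0 1 e f] by auto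

definition O_submodule :: "'l set \<Rightarrow> bool" where
  "O_submodule S \<longleftrightarrow> add_subgroup S \<and> (\<forall>c\<in>O\<^sub>K. \<forall>x\<in>S. emb c * x \<in> S)"

lemma O_submodule_lat: "O_submodule (lat e f)"
  unfolding O_submodule_def add_subgroup_def
proof (intro conjI ballI)
  show "0 \<in> lat e f" using lat_mem[of 0 0] by auto
  show "x - y \<in> lat e f" if xy: "x \<in> lat e f" "y \<in> lat e f" for x y
  proof -
    obtain a b c d where "x = emb a * e + emb b * f" "y = emb c * e + emb d * f"
      and abcd: "a \<in> O\<^sub>K" "b \<in> O\<^sub>K" "c \<in> O\<^sub>K" "d \<in> O\<^sub>K"
      using xy unfolding lat_def by blast
    then have "x - y = emb (a - c) * e + emb (b - d) * f" by (simp add: algebra_simps)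
    then show ?thesis using abcd by (simp add: lat_mem del: emb_hom)
  qed
  show "emb c * x \<in> lat e f" if cx: "c \<in> O\<^sub>K" "x \<in> lat e f" for c x
  proof -
    obtain a b where "x = emb a * e + emb b * f" and ab: "a \<in> O\<^sub>K" "b \<in> O\<^sub>K"
      using cx unfolding lat_def by blast
    then have "emb c * x = emb (c * a) * e + emb (c * b) * f" by (simp add: algebra_simps)
    then show ?thesis using ab cx by (simp add: lat_mem del: emb_hom)
  qed
qed

lemma O_submoduleD:
  assumes "O_submodule S"
  shows "add_subgroup S" "c \<in> O\<^sub>K \<Longrightarrow> x \<in> S \<Longrightarrow> emb c * x \<in> S"
    "x \<in> S \<Longrightarrow> y \<in> S \<Longrightarrow> x + y \<in> S" "x \<in> S \<Longrightarrow> y \<in> S \<Longrightarrow> x - y \<in> S"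
  using assms add_subgroupD[of S] by (auto simp: O_submodule_def)

lemma lat_subset_iff: "O_submodule S \<Longrightarrow> lat e f \<subseteq> S \<longleftrightarrow> e \<in> S \<and> f \<in> S"
  using lat_basis O_submoduleD(2,3) unfolding lat_def by auto

lemma lattice_O_submodule: "is_lattice v smul \<Lambda> \<Longrightarrow> O_submodule \<Lambda>"
  by (auto simp: is_lattice_iff O_submodule_lat)

lemma lattice_add_subgroup: "is_lattice v smul \<Lambda> \<Longrightarrow> add_subgroup \<Lambda>"
  using lattice_O_submodule O_submoduleD(1) by blast

lemma image_mult_lat: "(*) z ` lat e f = lat (z * e) (z * f)"
proof -
  have "z * (emb x * e + emb y * f) = emb x * (z * e) + emb y * (z * f)" for x y
    by (simp add: algebra_simps)
  then show ?thesis unfolding lat_def by (fastforce simp: image_iff)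
qed

lemma indep_mult: "indep e f \<Longrightarrow> z * w = 1 \<Longrightarrow> indep (z * e) (z * f)"
proof -
  assume h: "indep e f" "z * w = 1"
  show ?thesis unfolding indep_def
  proof (intro allI impI)
    fix x y assume "emb x * (z * e) + emb y * (z * f) = 0"
    then have "w * (emb x * (z * e) + emb y * (z * f)) = 0" by simp
    then have "(z * w) * (emb x * e + emb y * f) = 0" by (simp add: algebra_simps)
    then show "x = 0 \<and> y = 0" using h indepD by simp
  qed
qed

lemma lattice_mult: "is_lattice v smul \<Lambda> \<Longrightarrow> z * w = 1 \<Longrightarrow> is_lattice v smul ((*) z ` \<Lambda>)"
  using indep_mult image_mult_lat unfolding is_lattice_iff by blast

lemma image_smul: "smul c ` \<Lambda> = (*) (emb c) ` \<Lambda>"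
  by (simp add: smul_eq)

lemma lattice_smul: "is_lattice v smul \<Lambda> \<Longrightarrow> c \<noteq> 0 \<Longrightarrow> is_lattice v smul (smul c ` \<Lambda>)"
  unfolding image_smul using lattice_mult emb_inverse by blast

lemma image_mult_image: "(*) (z::'l) ` ((*) w ` \<Lambda>) = (*) (z * w) ` \<Lambda>"
  by (auto simp: image_image mult.assoc)

lemma image_mult_unit_subset_iff:
  assumes "z * w = (1::'l)"
  shows "(*) z ` A \<subseteq> (*) z ` B \<longleftrightarrow> A \<subseteq> B"
proof -
  have "inj ((*) z)" by (rule injI) (metis assms mult.commute mult.assoc mult_1)
  then show ?thesis by (simp add: inj_image_subset_iff)
qed

lemma smul_image_subset_iff: "c \<noteq> 0 \<Longrightarrow> smul c ` A \<subseteq> smul c ` B \<longleftrightarrow> A \<subseteq> B"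
  unfolding image_smul using image_mult_unit_subset_iff emb_inverse by blast

lemma smul_image_subset: "O_submodule S \<Longrightarrow> c \<in> O\<^sub>K \<Longrightarrow> smul c ` S \<subseteq> S"
  using O_submoduleD(2) by (auto simp: smul_eq)

text \<open>A vector outside p \<Lambda> has a unit among its coordinates and can replace the
  corresponding basis vector.\<close>

lemma lattice_extend_basis:
  assumes "is_lattice v smul \<Lambda>" "w \<in> \<Lambda>" "w \<notin> smul p ` \<Lambda>"
  obtains g where "indep w g" "\<Lambda> = lat w g"
proof -
  note basis = that
  \<comment> \<open>The coordinate at e is assumed to be a unit; the other case follows by
    exchanging e and f.\<close>
  have main: thesis if ef: "indep e f" "\<Lambda> = lat e f" and w: "w = emb x * e + emb y * f"
    and xy: "x \<in> O\<^sub>K" "y \<in> O\<^sub>K" "x \<noteq> 0" "v x = 0" for e f x y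
  proof (rule basis[of f])
    show "indep w f" unfolding indep_def
    proof (intro allI impI)
      fix a b assume "emb a * w + emb b * f = 0"
      then have "emb (a * x) * e + emb (a * y + b) * f = 0" by (simp add: w algebra_simps)
      then have "a * x = 0 \<and> a * y + b = 0" by (rule indepD[OF ef(1)])
      then show "a = 0 \<and> b = 0" using xy by auto
    qed
    have xi: "inverse x \<in> O\<^sub>K" using val_ring_unit xy by blast
    have "e = (emb x * emb (inverse x)) * e" using emb_inverse xy by simp
    also have "\<dots> = emb (inverse x) * w + emb (- inverse x * y) * f"
      by (simp add: w algebra_simps)
    finally have "e \<in> lat w f" using lat_mem[of "inverse x" "- inverse x * y" w f] xi xy
      by (simp del: emb_hom)
    then have "lat e f \<subseteq> lat w f" by (simp add: lat_subset_iff O_submodule_lat lat_basis)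
    moreover have "lat w f \<subseteq> lat e f" using xy
      by (auto simp: lat_subset_iff O_submodule_lat lat_basis w lat_mem)
    ultimately show "\<Lambda> = lat w f" using ef by simp
  qed
  obtain e f where ef: "indep e f" "\<Lambda> = lat e f" using assms(1) by (auto simp: is_lattice_iff)
  obtain x y where w: "w = emb x * e + emb y * f" and xy: "x \<in> O\<^sub>K" "y \<in> O\<^sub>K"
    using assms(2) ef(2) by (auto simp: lat_def)
  consider "x \<noteq> 0 \<and> v x = 0" | "y \<noteq> 0 \<and> v y = 0"
    | "\<not> (x \<noteq> 0 \<and> v x = 0)" "\<not> (y \<noteq> 0 \<and> v y = 0)" by blast
  then show thesis
  proof cases
    case 1 then show ?thesis using main[OF ef w xy] by blast
  next
    case 2
    have "w = emb y * f + emb x * e" using w by simp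
    then show ?thesis using main[of f e y x] 2 ef xy indep_commute lat_commute by blast
  next
    case 3
    obtain x' y' where xy': "x' \<in> O\<^sub>K" "x = p * x'" "y' \<in> O\<^sub>K" "y = p * y'"
      using val_ring_nonunit 3 xy by metis
    then have "w = smul p (emb x' * e + emb y' * f)" by (simp add: w smul_eq algebra_simps)
    then have "w \<in> smul p ` \<Lambda>" using ef lat_mem xy' by auto
    then show ?thesis using assms(3) by blast
  qed
qed

text \<open>Serves two purposes: every proper submodule lies in a sublattice of index q, which
  drives the descent in \<open>steps_exist\<close>, and a lattice strictly between p \<Lambda> and
  \<Lambda> is itself of the form \<open>lat e (emb p * f)\<close>. The vector e is taken in S
  outside p \<Lambda> whenever there is one.\<close>

lemma proper_submodule_basis:
  assumes "is_lattice v smul \<Lambda>" "O_submodule S" "S \<subset> \<Lambda>"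
  obtains e f where "indep e f" "\<Lambda> = lat e f" "S \<subseteq> lat e (emb p * f)"
    "S \<subseteq> smul p ` \<Lambda> \<or> S = lat e (emb p * f) \<or> \<not> smul p ` \<Lambda> \<subseteq> S"
proof (cases "S \<subseteq> smul p ` \<Lambda>")
  case True
  obtain e f where ef: "indep e f" "\<Lambda> = lat e f" using assms(1) by (auto simp: is_lattice_iff)
  have "smul p ` \<Lambda> = lat (emb p * e) (emb p * f)" by (simp add: ef(2) image_smul image_mult_lat)
  also have "\<dots> \<subseteq> lat e (emb p * f)"
    by (simp add: lat_subset_iff O_submodule_lat lat_basis O_submoduleD(2))
  finally show ?thesis using that ef True by blast
next
  case False
  then obtain e where e: "e \<in> S" "e \<notin> smul p ` \<Lambda>" by blast
  then obtain f where ef: "indep e f" "\<Lambda> = lat e f"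
    using lattice_extend_basis assms by blast
  have sub: "S \<subseteq> lat e (emb p * f)"
  proof
    fix s assume s: "s \<in> S"
    then obtain a b where ab: "s = emb a * e + emb b * f" "a \<in> O\<^sub>K" "b \<in> O\<^sub>K"
      using assms(3) ef unfolding lat_def by blast
    have "\<not> (b \<noteq> 0 \<and> v b = 0)"
    proof
      \<comment> \<open>A unit coefficient would put f, and with it all of \<Lambda>, into
        S.\<close>
      assume b: "b \<noteq> 0 \<and> v b = 0"
      have "f = emb b * emb (inverse b) * f" using emb_inverse b by simp
      also have "\<dots> = emb (inverse b) * (s - emb a * e)" by (simp add: ab algebra_simps)
      also have "\<dots> \<in> S" using s e ab val_ring_unit b
        by (intro O_submoduleD(2,4)[OF assms(2)]) auto
      finally have "lat e f \<subseteq> S" using e by (simp add: lat_subset_iff assms(2))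
      then show False using ef assms(3) by blast
    qed
    then obtain b' where "b' \<in> O\<^sub>K" "b = p * b'" using val_ring_nonunit ab by blast
    then show "s \<in> lat e (emb p * f)" using lat_mem[of a b' e "emb p * f"] ab
      by (simp add: algebra_simps)
  qed
  have "S = lat e (emb p * f)" if "smul p ` \<Lambda> \<subseteq> S"
  proof -
    have "emb p * f \<in> S" using that ef lat_basis by (auto simp: smul_eq)
    then show ?thesis using sub e by (simp add: lat_subset_iff assms(2) subset_antisym)
  qed
  then show ?thesis using that ef sub by blast
qed

text \<open>The first coordinate is unrestricted in both lattices, so the quotient is the residue
  field: its representatives times f represent the cosets.\<close>

lemma lat_index_step:
  assumes "indep e f"
  shows "finite (add_cosets (lat e f) (lat e (emb p * f)))"
    "add_index (lat e f) (lat e (emb p * f)) = residue_card v"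
proof -
  have g: "add_subgroup O\<^sub>K" "add_subgroup (val_max_ideal v)" "val_max_ideal v \<subseteq> O\<^sub>K"
    unfolding val_max_ideal_eq by (auto simp: add_subgroup_def simp flip: right_diff_distrib)
  obtain R where R: "transversal O\<^sub>K (val_max_ideal v) R" using transversal_exists g by blast
  let ?T = "(\<lambda>b. emb b * f) ` R"
  have inj: "inj_on (\<lambda>b. emb b * f) R"
    by (rule inj_onI) (use indep_unique[OF assms, of 0 _ 0] in auto)
  have key: "emb x * e + emb y * f - emb b * f \<in> lat e (emb p * f) \<longleftrightarrow> y - b \<in> val_max_ideal v"
    if x: "x \<in> O\<^sub>K" for x y b
  proof
    assume "emb x * e + emb y * f - emb b * f \<in> lat e (emb p * f)"
    then obtain c d where cd: "c \<in> O\<^sub>K" "d \<in> O\<^sub>K"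
      "emb x * e + emb (y - b) * f = emb c * e + emb (p * d) * f"
      by (auto simp: lat_def algebra_simps)
    then show "y - b \<in> val_max_ideal v"
      using indep_unique[OF assms cd(3)] by (auto simp: val_max_ideal_eq)
  next
    assume "y - b \<in> val_max_ideal v"
    then obtain d where d: "d \<in> O\<^sub>K" "y - b = p * d" by (auto simp: val_max_ideal_eq)
    have "emb x * e + emb y * f - emb b * f = emb x * e + emb (y - b) * f"
      by (simp add: algebra_simps)
    also have "\<dots> = emb x * e + emb d * (emb p * f)" unfolding d(2) by (simp add: algebra_simps)
    finally show "emb x * e + emb y * f - emb b * f \<in> lat e (emb p * f)"
      using lat_mem[OF x d(1), of e "emb p * f"] by argo
  qed
  have RO: "R \<subseteq> O\<^sub>K" using R by (auto simp: transversal_def)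
  have T: "transversal (lat e f) (lat e (emb p * f)) ?T"
    unfolding transversal_def
  proof (intro conjI ballI)
    show "?T \<subseteq> lat e f"
    proof (rule image_subsetI)
      fix b assume "b \<in> R"
      then show "emb b * f \<in> lat e f" using lat_mem[of 0 b e f] RO by auto
    qed
    fix z assume "z \<in> lat e f"
    then obtain x y where z: "z = emb x * e + emb y * f" and xy: "x \<in> O\<^sub>K" "y \<in> O\<^sub>K"
      by (auto simp: lat_def)
    have "\<exists>!b. b \<in> R \<and> y - b \<in> val_max_ideal v" using R xy by (simp add: transversal_def)
    then show "\<exists>!r. r \<in> ?T \<and> z - r \<in> lat e (emb p * f)"
      using key[OF xy(1), of y] unfolding z by (auto simp: image_iff)
  qed
  have sub: "lat e (emb p * f) \<subseteq> lat e f"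
    by (simp add: lat_subset_iff O_submodule_lat lat_basis O_submoduleD(2))
  have b: "bij_betw (\<lambda>x. {y \<in> lat e f. x - y \<in> lat e (emb p * f)}) ?T
      (add_cosets (lat e f) (lat e (emb p * f)))"
    by (intro transversal_bij O_submoduleD(1) O_submodule_lat sub T)
  have b': "bij_betw (\<lambda>x. {y \<in> O\<^sub>K. x - y \<in> val_max_ideal v}) R (add_cosets O\<^sub>K (val_max_ideal v))"
    by (intro transversal_bij g R)
  show "finite (add_cosets (lat e f) (lat e (emb p * f)))"
    using bij_betw_finite[OF b] bij_betw_finite[OF b'] residue_finite by simp
  show "add_index (lat e f) (lat e (emb p * f)) = residue_card v"
    using bij_betw_same_card[OF b] bij_betw_same_card[OF b'] card_image[OF inj]
    by (simp add: add_index_def residue_card_def)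
qed

end

subsection \<open>Walks in the tree\<close>

context local_quadratic_algebra
begin

abbreviation "lattice \<equiv> is_lattice v smul"
abbreviation "cls \<equiv> homothety_class smul"
abbreviation "V \<equiv> bt_vertices v smul"
abbreviation "E \<equiv> bt_edges v smul p"
abbreviation "q \<equiv> residue_card v"

text \<open>The edge relation on lattices instead of classes: here chains are descending and indices
  multiply along them.\<close>

definition step :: "('l set \<times> 'l set) set" where
  "step = {(\<Lambda>, \<Lambda>'). lattice \<Lambda> \<and> lattice \<Lambda>' \<and> smul p ` \<Lambda> \<subset> \<Lambda>' \<and> \<Lambda>' \<subset> \<Lambda>}"

lemma step_index:
  assumes "(\<Lambda>, \<Lambda>') \<in> step"
  shows "finite (add_cosets \<Lambda> \<Lambda>')" "add_index \<Lambda> \<Lambda>' = q"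
proof -
  have h: "lattice \<Lambda>" "lattice \<Lambda>'" "smul p ` \<Lambda> \<subset> \<Lambda>'" "\<Lambda>' \<subset> \<Lambda>" using assms by (auto simp: step_def)
  obtain e f where ef: "indep e f" "\<Lambda> = lat e f"
    and "\<Lambda>' \<subseteq> smul p ` \<Lambda> \<or> \<Lambda>' = lat e (emb p * f) \<or> \<not> smul p ` \<Lambda> \<subseteq> \<Lambda>'"
    by (rule proper_submodule_basis[OF h(1) lattice_O_submodule[OF h(2)] h(4)])
  then have L': "\<Lambda>' = lat e (emb p * f)" using h(3) by blast
  show "finite (add_cosets \<Lambda> \<Lambda>')" "add_index \<Lambda> \<Lambda>' = q"
    unfolding ef(2) L' by (fact lat_index_step[OF ef(1)])+
qed

lemma step_lat:
  assumes "indep e f"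
  shows "(lat e f, lat e (emb p * f)) \<in> step"
proof -
  have ind: "indep e (emb p * f)" unfolding indep_def
  proof (intro allI impI)
    fix x y assume "emb x * e + emb y * (emb p * f) = 0"
    then have "emb x * e + emb (y * p) * f = 0" by (simp add: algebra_simps)
    then show "x = 0 \<and> y = 0" using indepD[OF assms, of x "y * p"] by simp
  qed
  have eq: "smul p ` lat e f = lat (emb p * e) (emb p * f)" by (simp add: image_smul image_mult_lat)
  have 1: "lat (emb p * e) (emb p * f) \<subseteq> lat e (emb p * f)"
    by (simp add: lat_subset_iff O_submodule_lat lat_basis O_submoduleD(2))
  have 2: "lat e (emb p * f) \<subseteq> lat e f"
    by (simp add: lat_subset_iff O_submodule_lat lat_basis O_submoduleD(2))
  \<comment> \<open>That p is not a unit of \<open>O\<^sub>K\<close> makes both inclusions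
    strict.\<close>
  have ninv: "p * x \<noteq> 1" if "x \<in> O\<^sub>K" for x
  proof
    assume h: "p * x = 1"
    then have "x \<noteq> 0" by auto
    then have "v (p * x) = 1 + v x" by (simp add: val_mult)
    then show False using h that \<open>x \<noteq> 0\<close> by (auto simp: val_ring_iff)
  qed
  have "e \<notin> lat (emb p * e) (emb p * f)"
  proof
    assume "e \<in> lat (emb p * e) (emb p * f)"
    then obtain x y where xy: "x \<in> O\<^sub>K" "e = emb x * (emb p * e) + emb y * (emb p * f)"
      by (auto simp: lat_def)
    have "emb 1 * e + emb 0 * f = emb (p * x) * e + emb (p * y) * f"
      using xy(2) by (simp add: algebra_simps)
    then show False using indep_unique[OF assms, of 1 0 "p * x" "p * y"] ninv[OF xy(1)] by simp
  qed
  moreover have "f \<notin> lat e (emb p * f)"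
  proof
    assume "f \<in> lat e (emb p * f)"
    then obtain x y where xy: "y \<in> O\<^sub>K" "f = emb x * e + emb y * (emb p * f)"
      by (auto simp: lat_def)
    have "emb 0 * e + emb 1 * f = emb x * e + emb (p * y) * f"
      using xy(2) by (simp add: algebra_simps)
    then show False using indep_unique[OF assms, of 0 1 x "p * y"] ninv[OF xy(1)] by simp
  qed
  ultimately have "smul p ` lat e f \<subset> lat e (emb p * f) \<and> lat e (emb p * f) \<subset> lat e f"
    using 1 2 eq lat_basis by blast
  then show ?thesis using ind assms by (auto simp: step_def is_lattice_iff)
qed

lemma index_self: "add_subgroup A \<Longrightarrow> add_cosets A A = {A}"
  using add_subgroupD[of A] by (auto simp: add_cosets_eq_image)

lemma steps_index:
  assumes "(\<Lambda>, \<Lambda>') \<in> step ^^ d" "lattice \<Lambda>"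
  shows "lattice \<Lambda>'" "\<Lambda>' \<subseteq> \<Lambda>" "finite (add_cosets \<Lambda> \<Lambda>')" "add_index \<Lambda> \<Lambda>' = q ^ d"
    "smul (p ^ d) ` \<Lambda> \<subseteq> \<Lambda>'"
proof -
  have "lattice \<Lambda>' \<and> \<Lambda>' \<subseteq> \<Lambda> \<and> finite (add_cosets \<Lambda> \<Lambda>') \<and> add_index \<Lambda> \<Lambda>' = q ^ d
      \<and> smul (p ^ d) ` \<Lambda> \<subseteq> \<Lambda>'"
    using assms(1)
  proof (induction d arbitrary: \<Lambda>')
    case 0
    then show ?case using assms(2) index_self[OF lattice_add_subgroup]
      by (auto simp: add_index_def)
  next
    case (Suc d)
    then obtain M where M: "(\<Lambda>, M) \<in> step ^^ d" "(M, \<Lambda>') \<in> step" by auto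
    note IH = Suc.IH[OF M(1)]
    have l: "lattice M" "lattice \<Lambda>'" "\<Lambda>' \<subseteq> M" "smul p ` M \<subseteq> \<Lambda>'"
      using M(2) by (auto simp: step_def)
    note tower = add_cosets_tower[OF lattice_add_subgroup[OF assms(2)] lattice_add_subgroup[OF l(1)]
      lattice_add_subgroup[OF l(2)] _ l(3)]
    have "smul (p ^ Suc d) ` \<Lambda> = smul p ` (smul (p ^ d) ` \<Lambda>)" by (simp add: image_image)
    then have "smul (p ^ Suc d) ` \<Lambda> \<subseteq> \<Lambda>'" using IH l(4) by (metis image_mono subset_trans)
    then show ?case using IH l tower step_index[OF M(2)] by auto
  qed
  then show "lattice \<Lambda>'" "\<Lambda>' \<subseteq> \<Lambda>" "finite (add_cosets \<Lambda> \<Lambda>')" "add_index \<Lambda> \<Lambda>' = q ^ d"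
    "smul (p ^ d) ` \<Lambda> \<subseteq> \<Lambda>'" by auto
qed

text \<open>Each factor p takes two steps, one for each basis vector, in accordance with the index
  q^2 of p \<Lambda> in \<Lambda>.\<close>

lemma steps_scale:
  assumes "lattice \<Lambda>"
  shows "(\<Lambda>, smul (p ^ k) ` \<Lambda>) \<in> step ^^ (2 * k)"
proof (induction k)
  case (Suc k)
  have "lattice (smul (p ^ k) ` \<Lambda>)" by (rule lattice_smul[OF assms]) simp
  then obtain e f where ef: "indep e f" "smul (p ^ k) ` \<Lambda> = lat e f" by (auto simp: is_lattice_iff)
  have s1: "(lat e f, lat e (emb p * f)) \<in> step" by (rule step_lat[OF ef(1)])
  have "indep (emb p * f) e"
    unfolding indep_def
  proof (intro allI impI)
    fix x y assume "emb x * (emb p * f) + emb y * e = 0"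
    then have "emb y * e + emb (x * p) * f = 0" by (simp add: algebra_simps)
    then show "x = 0 \<and> y = 0" using indepD[OF ef(1), of y "x * p"] by simp
  qed
  from step_lat[OF this] have s2: "(lat e (emb p * f), lat (emb p * e) (emb p * f)) \<in> step"
    by (simp add: lat_commute)
  have "smul (p ^ Suc k) ` \<Lambda> = smul p ` (smul (p ^ k) ` \<Lambda>)" by (simp add: image_image)
  also have "\<dots> = lat (emb p * e) (emb p * f)" unfolding ef(2) by (simp add: image_smul image_mult_lat)
  finally have "(smul (p ^ k) ` \<Lambda>, smul (p ^ Suc k) ` \<Lambda>) \<in> step O step" using s1 s2 ef(2) by auto
  then show ?case using Suc by (auto simp: O_assoc)
qed simp

lemma lattice_scale:
  assumes "lattice \<Lambda>" "lattice \<Lambda>'"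
  obtains k where "smul (p ^ k) ` \<Lambda> \<subseteq> \<Lambda>'"
proof -
  obtain e f where ef: "indep e f" "\<Lambda> = lat e f" using assms by (auto simp: is_lattice_iff)
  obtain g h where gh: "indep g h" "\<Lambda>' = lat g h" using assms by (auto simp: is_lattice_iff)
  have "\<exists>k. \<forall>l\<ge>k. emb (p ^ l) * z \<in> lat g h" for z
  proof -
    obtain x y where z: "z = emb x * g + emb y * h" using indep_span gh(1) by blast
    obtain k l where "\<forall>i\<ge>k. p ^ i * x \<in> O\<^sub>K" "\<forall>i\<ge>l. p ^ i * y \<in> O\<^sub>K" using val_ring_scale by metis
    then have "\<forall>i\<ge>max k l. emb (p ^ i * x) * g + emb (p ^ i * y) * h \<in> lat g h"
      by (simp add: lat_mem del: emb_hom)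
    moreover have "emb (p ^ i) * z = emb (p ^ i * x) * g + emb (p ^ i * y) * h" for i
      by (simp add: z algebra_simps)
    ultimately show ?thesis by metis
  qed
  then obtain k l where kl: "\<forall>i\<ge>k. emb (p ^ i) * e \<in> lat g h" "\<forall>i\<ge>l. emb (p ^ i) * f \<in> lat g h" by metis
  have "smul (p ^ max k l) ` \<Lambda> \<subseteq> \<Lambda>'"
    unfolding ef gh image_smul image_mult_lat using kl by (simp add: lat_subset_iff O_submodule_lat)
  then show ?thesis by (rule that)
qed

text \<open>Descent on the index: a proper sublattice lies in some sublattice of index q, and
  passing to that one divides the remaining index by q. The index is finite because the sublattice
  contains some p^k \<Lambda>.\<close>

lemma steps_exist:
  assumes "lattice \<Lambda>" "lattice \<Lambda>'" "\<Lambda>' \<subseteq> \<Lambda>"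
  shows "\<exists>d. (\<Lambda>, \<Lambda>') \<in> step ^^ d"
proof -
  obtain k where k: "smul (p ^ k) ` \<Lambda> \<subseteq> \<Lambda>'" using lattice_scale assms by blast
  have lk: "lattice (smul (p ^ k) ` \<Lambda>)" by (rule lattice_smul[OF assms(1)]) simp
  have "finite (add_cosets \<Lambda> (smul (p ^ k) ` \<Lambda>))"
    using steps_index(3)[OF steps_scale[OF assms(1)] assms(1)] .
  then have "finite (add_cosets \<Lambda> \<Lambda>')"
    using add_cosets_tower(2)[OF lattice_add_subgroup lattice_add_subgroup lattice_add_subgroup, OF assms(1,2) lk assms(3) k]
    by simp
  then show ?thesis using assms
  proof (induction "add_index \<Lambda> \<Lambda>'" arbitrary: \<Lambda> rule: less_induct)
    case less
    show ?case
    proof (cases "\<Lambda>' = \<Lambda>")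
      case True
      then have "(\<Lambda>, \<Lambda>') \<in> step ^^ 0" by simp
      then show ?thesis by blast
    next
      case False
      then have "\<Lambda>' \<subset> \<Lambda>" using less.prems(4) by blast
      from proper_submodule_basis[OF less.prems(2) lattice_O_submodule[OF less.prems(3)] this]
      obtain e f where ef: "indep e f" "\<Lambda> = lat e f" "\<Lambda>' \<subseteq> lat e (emb p * f)"
        by metis
      let ?M = "lat e (emb p * f)"
      have st: "(\<Lambda>, ?M) \<in> step" using step_lat ef by simp
      then have M: "lattice ?M" "?M \<subseteq> \<Lambda>" by (auto simp: step_def)
      note tower = add_cosets_tower[OF lattice_add_subgroup lattice_add_subgroup lattice_add_subgroup,
          OF less.prems(2) M(1) less.prems(3) M(2) ef(3)]
      have "finite (add_cosets ?M \<Lambda>')" using tower less by simp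
      moreover have "add_cosets ?M \<Lambda>' \<noteq> {}"
        using add_subgroupD(1)[OF lattice_add_subgroup[OF M(1)]] by (auto simp: add_cosets_eq_image)
      ultimately have "add_index ?M \<Lambda>' > 0" by (simp add: add_index_def card_gt_0_iff)
      then have "add_index ?M \<Lambda>' < add_index \<Lambda> \<Lambda>'"
        using tower step_index[OF st] residue_card_ge_2 by simp
      then obtain d where "(?M, \<Lambda>') \<in> step ^^ d"
        using less.hyps[OF _ \<open>finite (add_cosets ?M \<Lambda>')\<close> M(1) less.prems(3) ef(3)] by blast
      then have "(\<Lambda>, \<Lambda>') \<in> step ^^ Suc d" using st by (meson relpow_Suc_I2)
      then show ?thesis by blast
    qed
  qed
qed

section \<open>Homothety classes and the lifting of walks\<close>

lemma cls_self: "\<Lambda> \<in> cls \<Lambda>"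
  by (auto simp: homothety_class_def intro!: exI[of _ 1])

lemma smul_image_smul: "smul a ` (smul b ` \<Lambda>) = smul (a * b) ` \<Lambda>"
  by (simp add: image_image)

lemma cls_smul: "c \<noteq> 0 \<Longrightarrow> cls (smul c ` \<Lambda>) = cls \<Lambda>"
proof
  assume c: "c \<noteq> 0"
  show "cls (smul c ` \<Lambda>) \<subseteq> cls \<Lambda>" using c by (auto simp: homothety_class_def smul_image_smul)
  show "cls \<Lambda> \<subseteq> cls (smul c ` \<Lambda>)"
  proof
    fix M assume "M \<in> cls \<Lambda>"
    then obtain a where a: "a \<noteq> 0" "M = smul a ` \<Lambda>" by (auto simp: homothety_class_def)
    then have "M = smul (a / c) ` (smul c ` \<Lambda>)" "a / c \<noteq> 0" using c by (auto simp: smul_image_smul)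
    then show "M \<in> cls (smul c ` \<Lambda>)" unfolding homothety_class_def by blast
  qed
qed

lemma cls_mem_iff: "\<Lambda>' \<in> cls \<Lambda> \<longleftrightarrow> (\<exists>c. c \<noteq> 0 \<and> \<Lambda>' = smul c ` \<Lambda>)"
  by (auto simp: homothety_class_def)

lemma cls_memD: "\<Lambda>' \<in> cls \<Lambda> \<Longrightarrow> cls \<Lambda>' = cls \<Lambda>"
  using cls_smul by (auto simp: cls_mem_iff)

lemma cls_mem_lattice: "\<Lambda>' \<in> cls \<Lambda> \<Longrightarrow> lattice \<Lambda> \<Longrightarrow> lattice \<Lambda>'"
  using lattice_smul by (auto simp: cls_mem_iff)

lemma cls_eqD: "cls \<Lambda> = cls \<Lambda>' \<Longrightarrow> \<exists>c. c \<noteq> 0 \<and> \<Lambda>' = smul c ` \<Lambda>"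
  using cls_self[of \<Lambda>'] cls_mem_iff[of \<Lambda>' \<Lambda>] by simp

lemma vertex_iff: "x \<in> V \<longleftrightarrow> (\<exists>\<Lambda>. lattice \<Lambda> \<and> x = cls \<Lambda>)"
  by (auto simp: bt_vertices_def)

text \<open>If B = c A with v c >= 0, then B lies in A, and both have index q^d in \<Lambda>, so the
  index of B in A is 1. If v c < 0, the roles of A and B are exchanged.\<close>

lemma steps_class_inj:
  assumes "lattice \<Lambda>" "(\<Lambda>, A) \<in> step ^^ d" "(\<Lambda>, B) \<in> step ^^ d" "cls A = cls B"
  shows "A = B"
proof -
  have main: "A = B" if h: "(\<Lambda>, A) \<in> step ^^ d" "(\<Lambda>, B) \<in> step ^^ d" "B = smul c ` A" "c \<noteq> 0" "v c \<ge> 0"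
    for A B c
  proof -
    note A = steps_index[OF h(1) assms(1)] note B = steps_index[OF h(2) assms(1)]
    have "B \<subseteq> A" using h smul_image_subset[OF lattice_O_submodule[OF A(1)], of c]
      by (simp add: val_ring_iff)
    then have "add_index \<Lambda> B = add_index \<Lambda> A * add_index A B"
      using add_cosets_tower(1)[OF lattice_add_subgroup lattice_add_subgroup lattice_add_subgroup,
          OF assms(1) A(1) B(1) A(2)] by simp
    then have "add_index A B = 1" using A B residue_card_ge_2 by simp
    then show ?thesis
      using add_index_eq_1_imp_eq[OF lattice_add_subgroup lattice_add_subgroup, OF A(1) B(1)] \<open>B \<subseteq> A\<close>
      by simp
  qed
  obtain c where c: "c \<noteq> 0" "B = smul c ` A" using cls_eqD assms by blast
  show ?thesis
  proof (cases "v c \<ge> 0")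
    case True then show ?thesis using main[OF assms(2,3) c(2,1)] by simp
  next
    case False
    have "A = smul (inverse c) ` B" using c by (simp add: smul_image_smul)
    moreover have "inverse c \<noteq> 0" "v (inverse c) \<ge> 0" using c False by (auto simp: val_inverse)
    ultimately show ?thesis using main[OF assms(3,2)] by metis
  qed
qed

text \<open>Rescaling by the inverse of c moves the pair of representatives so that it starts at the
  prescribed lattice. This is what allows a whole walk to be lifted from one fixed starting
  lattice.\<close>

lemma edge_iff:
  assumes "lattice \<Lambda>"
  shows "(cls \<Lambda>, y) \<in> E \<longleftrightarrow> (\<exists>\<Lambda>'. (\<Lambda>, \<Lambda>') \<in> step \<and> y = cls \<Lambda>')"
proof
  assume "(cls \<Lambda>, y) \<in> E"
  then obtain M M' where M: "y \<in> V" "M \<in> cls \<Lambda>" "M' \<in> y" "smul p ` M \<subset> M'" "M' \<subset> M"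
    by (auto simp: bt_edges_def)
  obtain N where N: "lattice N" "y = cls N" using M(1) by (auto simp: vertex_iff)
  obtain c where c: "c \<noteq> 0" "M = smul c ` \<Lambda>" using M(2) by (auto simp: cls_mem_iff)
  let ?L = "smul (inverse c) ` M'"
  have sub: "smul (inverse c) ` A \<subset> smul (inverse c) ` B \<longleftrightarrow> A \<subset> B" for A B
    using smul_image_subset_iff[of "inverse c"] c(1) by (simp add: less_le_not_le)
  have 1: "smul (inverse c) ` (smul p ` M) = smul p ` \<Lambda>" and 2: "smul (inverse c) ` M = \<Lambda>"
    unfolding c(2) smul_image_smul using c(1) by (simp_all add: mult.left_commute)
  have "smul p ` \<Lambda> \<subset> ?L" using M(4) by (rule sub[of "smul p ` M" M', unfolded 1, THEN iffD2])
  moreover have "?L \<subset> \<Lambda>" using M(5) by (rule sub[of M' M, unfolded 2, THEN iffD2])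
  moreover have "lattice ?L" using cls_mem_lattice[OF _ N(1)] M(3) c(1) N(2) by (simp add: lattice_smul)
  moreover have "y = cls ?L" using cls_memD[of M' N] N(2) M(3) c(1) by (simp add: cls_smul)
  ultimately show "\<exists>\<Lambda>'. (\<Lambda>, \<Lambda>') \<in> step \<and> y = cls \<Lambda>'" using assms unfolding step_def
    by (intro exI[of _ ?L]) simp
next
  assume "\<exists>\<Lambda>'. (\<Lambda>, \<Lambda>') \<in> step \<and> y = cls \<Lambda>'"
  then obtain \<Lambda>' where L': "(\<Lambda>, \<Lambda>') \<in> step" "y = cls \<Lambda>'" by blast
  then have "cls \<Lambda> \<in> V" "y \<in> V" by (auto simp: vertex_iff step_def)
  moreover have "smul p ` \<Lambda> \<subset> \<Lambda>' \<and> \<Lambda>' \<subset> \<Lambda>" using L'(1) by (simp add: step_def)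
  ultimately show "(cls \<Lambda>, y) \<in> E" using L'(2) cls_self[of \<Lambda>] cls_self[of \<Lambda>']
    unfolding bt_edges_def by auto
qed

lemma walk_iff:
  assumes "lattice \<Lambda>"
  shows "(cls \<Lambda>, y) \<in> E ^^ d \<longleftrightarrow> (\<exists>\<Lambda>'. (\<Lambda>, \<Lambda>') \<in> step ^^ d \<and> y = cls \<Lambda>')"
proof (induction d arbitrary: y)
  case (Suc d)
  have "(cls \<Lambda>, y) \<in> E ^^ Suc d \<longleftrightarrow> (\<exists>M. (\<Lambda>, M) \<in> step ^^ d \<and> (cls M, y) \<in> E)"
    using Suc by auto
  also have "\<dots> \<longleftrightarrow> (\<exists>M. (\<Lambda>, M) \<in> step ^^ d \<and> (\<exists>\<Lambda>'. (M, \<Lambda>') \<in> step \<and> y = cls \<Lambda>'))"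
    using edge_iff[OF steps_index(1)[OF _ assms]] by (intro ex_cong1 conj_cong) auto
  finally show ?case by auto
qed auto

text \<open>The chain p \<Lambda> < \<Lambda>' < \<Lambda> yields p \<Lambda>' < p \<Lambda> <
  \<Lambda>'.\<close>

lemma edge_sym: "(x, y) \<in> E \<Longrightarrow> (y, x) \<in> E"
proof -
  assume h: "(x, y) \<in> E"
  then obtain \<Lambda> where L: "lattice \<Lambda>" "x = cls \<Lambda>" by (auto simp: bt_edges_def vertex_iff)
  then obtain \<Lambda>' where L': "(\<Lambda>, \<Lambda>') \<in> step" "y = cls \<Lambda>'" using h edge_iff by blast
  have "smul p ` A \<subset> smul p ` B \<longleftrightarrow> A \<subset> B" for A B
    using smul_image_subset_iff[of p] by (simp add: less_le_not_le)
  then have "(\<Lambda>', smul p ` \<Lambda>) \<in> step"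
    using L'(1) lattice_smul[of \<Lambda> p] unfolding step_def by simp
  moreover have "x = cls (smul p ` \<Lambda>)" using cls_smul L by simp
  moreover have "lattice \<Lambda>'" using L' by (simp add: step_def)
  ultimately show ?thesis using edge_iff[of \<Lambda>' x] L'(2) by auto
qed

lemma tree_connected: "x \<in> V \<Longrightarrow> y \<in> V \<Longrightarrow> \<exists>d. (x, y) \<in> E ^^ d"
proof -
  assume h: "x \<in> V" "y \<in> V"
  then obtain \<Lambda> M where L: "lattice \<Lambda>" "x = cls \<Lambda>" "lattice M" "y = cls M"
    by (auto simp: vertex_iff)
  obtain k where k: "smul (p ^ k) ` M \<subseteq> \<Lambda>" by (rule lattice_scale[OF L(3,1)])
  have "lattice (smul (p ^ k) ` M)" using lattice_smul L by simp
  then obtain d where "(\<Lambda>, smul (p ^ k) ` M) \<in> step ^^ d" using steps_exist[OF L(1) _ k] by blast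
  moreover have "y = cls (smul (p ^ k) ` M)" using L cls_smul by simp
  ultimately show ?thesis using walk_iff[OF L(1)] L(2) by auto
qed

end

section \<open>Thickenings and layers in a connected graph\<close>

lemma graph_setdist_le_1_iff:
  assumes "S \<noteq> {}" "\<And>y. y \<in> S \<Longrightarrow> \<exists>d. (x, y) \<in> E ^^ d"
  shows "graph_setdist E x S \<le> 1 \<longleftrightarrow> x \<in> S \<or> (\<exists>y\<in>S. (x, y) \<in> E)"
proof -
  have "graph_setdist E x S \<in> graph_dist E x ` S"
    unfolding graph_setdist_def using assms(1) by (intro Inf_nat_def1) simp
  then have "graph_setdist E x S \<le> 1 \<longleftrightarrow> (\<exists>y\<in>S. graph_dist E x y \<le> 1)"
    unfolding graph_setdist_def by (auto intro: order_trans[OF cInf_lower])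
  also have "\<dots> \<longleftrightarrow> (\<exists>y\<in>S. (x, y) \<in> E ^^ 0 \<or> (x, y) \<in> E ^^ 1)"
  proof (rule bex_cong)
    fix y assume "y \<in> S"
    then have "(x, y) \<in> E ^^ graph_dist E x y" using assms(2) unfolding graph_dist_def by (metis LeastI)
    moreover have "graph_dist E x y \<le> d" if "(x, y) \<in> E ^^ d" for d
      using that unfolding graph_dist_def by (rule Least_le)
    ultimately show "graph_dist E x y \<le> 1 \<longleftrightarrow> (x, y) \<in> E ^^ 0 \<or> (x, y) \<in> E ^^ 1"
      by (metis le_0_eq le_SucE One_nat_def le_SucI order_refl)
  qed simp
  finally show ?thesis by auto
qed

text \<open>Connectedness is needed because the distance between unconnected vertices is an
  unspecified number.\<close>

lemma thick_eqI:
  assumes conn: "\<And>x y. x \<in> V \<Longrightarrow> y \<in> V \<Longrightarrow> \<exists>d. (x, y) \<in> E ^^ d"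
    and sub: "\<And>n. T n \<subseteq> V" and ne: "T 0 \<noteq> {}" and mono: "\<And>n. T n \<subseteq> T (Suc n)"
    and up: "\<And>n x y. x \<in> V \<Longrightarrow> y \<in> T n \<Longrightarrow> (x, y) \<in> E \<Longrightarrow> x \<in> T (Suc n)"
    and down: "\<And>n x. x \<in> T (Suc n) \<Longrightarrow> x \<notin> T n \<Longrightarrow> \<exists>y\<in>T n. (x, y) \<in> E"
  shows "thick V E (T 0) n = T n"
proof (induction n)
  case (Suc n)
  have "T 0 \<subseteq> T n" by (rule lift_Suc_mono_le[of T]) (use mono in auto)
  then have "T n \<noteq> {}" using ne by auto
  then have "graph_setdist E x (T n) \<le> 1 \<longleftrightarrow> x \<in> T n \<or> (\<exists>y\<in>T n. (x, y) \<in> E)" if "x \<in> V" for x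
    using that conn sub by (intro graph_setdist_le_1_iff) blast+
  then have "thick V E (T 0) (Suc n) = {x \<in> V. x \<in> T n \<or> (\<exists>y\<in>T n. (x, y) \<in> E)}"
    using Suc by auto
  also have "\<dots> = T (Suc n)"
    using mono[of n] sub[of "Suc n"] up[of _ _ n] down[of _ n] by blast
  finally show ?case .
qed simp

text \<open>Quantifying over all m < n, rather than using n - 1, also covers layer 0, which is
  defined separately.\<close>

lemma layer_eqI:
  assumes "\<And>n. thick V E P n = T n" "\<And>n. T n \<subseteq> T (Suc n)"
  shows "x \<in> layer V E P n \<longleftrightarrow> x \<in> T n \<and> (\<forall>m<n. x \<notin> T m)"
proof (cases n)
  case 0
  then show ?thesis using assms(1)[of 0] by simp
next
  case (Suc k)
  have "T m \<subseteq> T k" if "m \<le> k" for m by (rule lift_Suc_mono_le[of T]) (use assms(2) that in auto)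
  then have "(\<forall>m<n. x \<notin> T m) \<longleftrightarrow> x \<notin> T k" using Suc by (auto simp: less_Suc_eq_le)
  then show ?thesis using Suc assms(1)[of n] assms(1)[of k] by simp
qed

lemma height_eqI:
  assumes "\<And>n. thick V E P n = T n" "\<And>n. T n \<subseteq> T (Suc n)" "x \<in> T n" "\<forall>m<n. x \<notin> T m"
  shows "height V E P x = n"
  unfolding height_def layer_eqI[OF assms(1,2)]
proof (rule the_equality)
  fix m assume "x \<in> T m \<and> (\<forall>k<m. x \<notin> T k)"
  then show "m = n" using assms(3,4) by (cases m n rule: linorder_cases) auto
qed (use assms in simp)

subsection \<open>The norm form and the structure of lattices\<close>

context local_quadratic_algebra
begin

lemma poly_at_0 [simp]: "poly_at smul 0 x = 0"
  by (simp add: poly_at_def)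

lemma poly_at_pCons [simp]: "poly_at smul (pCons a P) x = emb a + x * poly_at smul P x"
proof (cases "P = 0")
  case True
  then show ?thesis by (simp add: poly_at_def emb_def)
next
  case False
  then have "poly_at smul (pCons a P) x = (\<Sum>i\<le>Suc (degree P). emb (coeff (pCons a P) i) * x ^ i)"
    by (simp add: poly_at_def smul_eq)
  also have "\<dots> = emb a + (\<Sum>i\<le>degree P. emb (coeff P i) * x ^ Suc i)"
    by (subst sum.atMost_Suc_shift) simp
  also have "\<dots> = emb a + x * poly_at smul P x"
    by (simp add: poly_at_def smul_eq sum_distrib_left mult.left_commute)
  finally show ?thesis .
qed

lemma poly_at_add: "poly_at smul (P + Q) x = poly_at smul P x + poly_at smul Q x"
  by (induction P Q rule: poly_induct2) (auto simp: algebra_simps)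

lemma poly_at_emb: "poly_at smul P (emb c) = emb (poly P c)"
  by (induction P) auto

lemma emb_integral_iff: "emb c \<in> integral_closure v smul \<longleftrightarrow> c \<in> O\<^sub>K"
proof
  assume "emb c \<in> integral_closure v smul"
  then show "c \<in> O\<^sub>K"
    unfolding integral_closure_def using val_ring_integrally_closed by (auto simp: poly_at_emb)
next
  assume "c \<in> O\<^sub>K"
  then show "emb c \<in> integral_closure v smul"
    unfolding integral_closure_def
    by (auto intro!: exI[of _ "[:- c, 1:]"] simp: coeff_pCons split: nat.splits)
qed

lemma quadratic_integral:
  assumes "z * z = emb a * z - emb b" "a \<in> O\<^sub>K" "b \<in> O\<^sub>K"
  shows "z \<in> integral_closure v smul"
proof -
  let ?P = "[:b, - a, 1:]"
  have "poly_at smul ?P z = 0" using assms(1) by (simp add: algebra_simps)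
  moreover have "\<forall>i. coeff ?P i \<in> O\<^sub>K" using assms by (auto simp: coeff_pCons split: nat.splits)
  ultimately show ?thesis unfolding integral_closure_def
    by (intro CollectI exI[of _ ?P]) simp
qed

lemma exists_non_scalar: "\<exists>z. z \<notin> range emb"
proof (rule ccontr)
  assume "\<nexists>z. z \<notin> range emb"
  then have all: "\<exists>c. z = emb c" for z by (metis rangeE)
  obtain B where B: "independent B" "card B = dim UNIV"
    using basis_exists[of UNIV] by metis
  obtain a b where ab: "B = {a, b}" "a \<noteq> b" using B(2) dim_two by (auto simp: card_2_iff)
  then have ind: "indep a b" using B(1) indep_iff_independent by simp
  obtain \<alpha> \<beta> where "a = emb \<alpha>" "b = emb \<beta>" using all by metis
  \<comment> \<open>The relation used is \<beta> \<alpha> - \<alpha> \<beta> = 0.\<close>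
  then have "\<beta> = 0 \<and> - \<alpha> = 0" by (intro indepD[OF ind]) (simp add: mult.commute)
  then have "a = b" using \<open>a = emb \<alpha>\<close> \<open>b = emb \<beta>\<close> by simp
  then show False using ab by simp
qed

lemma indep_1_iff: "indep 1 z \<longleftrightarrow> z \<notin> range emb"
proof
  assume ind: "indep 1 z"
  show "z \<notin> range emb"
  proof
    assume "z \<in> range emb"
    then obtain c where "z = emb c" by auto
    then show False using indepD[OF ind, of "- c" 1] by simp
  qed
next
  assume z: "z \<notin> range emb"
  show "indep 1 z" unfolding indep_def
  proof (intro allI impI)
    fix x y assume eq: "emb x * 1 + emb y * z = 0"
    have "y = 0"
    proof (rule ccontr)
      assume y: "y \<noteq> 0"
      then have "emb y * emb (- x / y) = - emb x" by (simp flip: emb_hom)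
      then have "emb y * z = emb y * emb (- x / y)"
        using eq by (simp add: eq_neg_iff_add_eq_0 add.commute)
      then have "z = emb (- x / y)" using emb_cancel y by blast
      then show False using z by blast
    qed
    then show "x = 0 \<and> y = 0" using eq by simp
  qed
qed

end

locale monogenic_quadratic_algebra = local_quadratic_algebra v smul p
  for v :: "'k::field_char_0 \<Rightarrow> int" and smul :: "'k \<Rightarrow> 'l::comm_ring_1 \<Rightarrow> 'l" and p +
  fixes \<Delta> :: 'l
  assumes Delta_integral: "\<Delta> \<in> integral_closure v smul"
    and integral_closure_eq_adjoin: "integral_closure v smul = adjoin v smul \<Delta>"
begin

text \<open>If \<Delta> were a scalar, all integral elements would be scalars; but every non-scalar
  has an integral non-scalar multiple.\<close>

lemma indep_1_Delta: "indep 1 \<Delta>"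
proof (rule ccontr)
  assume "\<not> indep 1 \<Delta>"
  then obtain d where d: "\<Delta> = emb d" by (auto simp: indep_1_iff)
  obtain z where z: "z \<notin> range emb" using exists_non_scalar ..
  then have ind: "indep 1 z" using indep_1_iff by blast
  obtain \<alpha> \<beta> where zz: "z * z = emb \<alpha> * 1 + emb \<beta> * z" using indep_span[OF ind] by blast
  obtain k l where kl: "\<forall>i\<ge>k. p ^ i * \<alpha> \<in> O\<^sub>K" "\<forall>i\<ge>l. p ^ i * \<beta> \<in> O\<^sub>K" using val_ring_scale by metis
  \<comment> \<open>Scaling z by p^m multiplies the linear coefficient of its quadratic equation by
    p^m and the constant one by p^(2m).\<close>
  define m where "m = max k l"
  let ?w = "emb (p ^ m) * z"
  have "p ^ m * (p ^ m * \<alpha>) \<in> O\<^sub>K" "p ^ m * \<beta> \<in> O\<^sub>K" using kl by (auto simp: m_def)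
  moreover have "?w * ?w = emb (p ^ m * \<beta>) * ?w - emb (- (p ^ m * (p ^ m * \<alpha>)))"
  proof -
    have "?w * ?w = emb (p ^ m) * emb (p ^ m) * (z * z)" by (simp add: algebra_simps)
    then show ?thesis unfolding zz by (simp add: algebra_simps)
  qed
  ultimately have "?w \<in> integral_closure v smul" using quadratic_integral val_ring_closed(5) by blast
  then have "?w \<in> range emb"
    unfolding integral_closure_eq_adjoin adjoin_def d poly_at_emb by auto
  then obtain c where "?w = emb c" by auto
  then have "emb (p ^ m) * z = emb (p ^ m) * emb (c / p ^ m)" by (simp flip: emb_hom)
  then have "z = emb (c / p ^ m)" using emb_cancel[of "p ^ m"] by simp
  then show False using z by blast
qed

section \<open>Coordinates, conjugation and norm with respect to 1 and \<Delta>\<close>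

definition cx :: "'l \<Rightarrow> 'k" where "cx z = (THE x. \<exists>y. z = emb x + emb y * \<Delta>)"
definition cy :: "'l \<Rightarrow> 'k" where "cy z = (THE y. \<exists>x. z = emb x + emb y * \<Delta>)"

lemma coord_unique: "emb x + emb y * \<Delta> = emb x' + emb y' * \<Delta> \<longleftrightarrow> x = x' \<and> y = y'"
  using indep_unique[OF indep_1_Delta, of x y x' y'] by auto

lemma coord_eq [simp]: "cx (emb x + emb y * \<Delta>) = x" "cy (emb x + emb y * \<Delta>) = y"
  unfolding cx_def cy_def coord_unique by auto

lemma coords: "z = emb (cx z) + emb (cy z) * \<Delta>"
proof -
  obtain x y where "z = emb x * 1 + emb y * \<Delta>" using indep_span[OF indep_1_Delta] .
  then have "z = emb x + emb y * \<Delta>" by simp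
  then show ?thesis using coord_eq by metis
qed

lemma coord_eqI: "z = emb x + emb y * \<Delta> \<Longrightarrow> cx z = x \<and> cy z = y"
  by simp

text \<open>Trace and norm of \<Delta>, read off from its quadratic equation; hence the sign in
  \<open>nm\<close>.\<close>

definition tr where "tr = cy (\<Delta> * \<Delta>)"
definition nm where "nm = - cx (\<Delta> * \<Delta>)"

lemma Delta_square: "\<Delta> * \<Delta> = emb tr * \<Delta> - emb nm"
  using coords[of "\<Delta> * \<Delta>"] by (simp add: tr_def nm_def add.commute)

lemma coord_emb [simp]: "cx (emb c) = c" "cy (emb c) = 0"
  using coord_eqI[of "emb c" c 0] by auto

lemma coord_Delta [simp]: "cx \<Delta> = 0" "cy \<Delta> = 1"
  using coord_eqI[of \<Delta> 0 1] by auto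

lemma coord_add [simp]: "cx (z + w) = cx z + cx w" "cy (z + w) = cy z + cy w"
proof -
  have "z + w = emb (cx z + cx w) + emb (cy z + cy w) * \<Delta>"
    by (subst coords[of z], subst coords[of w]) (simp add: algebra_simps)
  then show "cx (z + w) = cx z + cx w" "cy (z + w) = cy z + cy w" using coord_eqI by blast+
qed

lemma coord_mult [simp]: "cx (z * w) = cx z * cx w - nm * cy z * cy w"
  "cy (z * w) = cx z * cy w + cy z * cx w + tr * cy z * cy w"
proof -
  have "z * w = emb (cx z) * emb (cx w) + (emb (cx z) * emb (cy w) + emb (cy z) * emb (cx w)) * \<Delta>
      + emb (cy z) * emb (cy w) * (\<Delta> * \<Delta>)"
    by (subst coords[of z], subst coords[of w]) (simp add: algebra_simps)
  also have "\<dots> = emb (cx z * cx w - nm * cy z * cy w)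
      + emb (cx z * cy w + cy z * cx w + tr * cy z * cy w) * \<Delta>"
    unfolding Delta_square by (simp add: algebra_simps)
  finally show "cx (z * w) = cx z * cx w - nm * cy z * cy w"
    "cy (z * w) = cx z * cy w + cy z * cx w + tr * cy z * cy w" using coord_eqI by blast+
qed

lemma coord_ext: "cx z = cx w \<Longrightarrow> cy z = cy w \<Longrightarrow> z = w"
  using coords by metis

text \<open>The nontrivial involution of L over K, which sends \<Delta> to tr - \<Delta>; in the
  split case it exchanges the two factors.\<close>

definition cj :: "'l \<Rightarrow> 'l" where "cj z = emb (cx z + tr * cy z) + emb (- cy z) * \<Delta>"

lemma coord_cj [simp]: "cx (cj z) = cx z + tr * cy z" "cy (cj z) = - cy z"
  unfolding cj_def by (simp_all only: coord_eq)

lemma cj_add: "cj (z + w) = cj z + cj w"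
  by (rule coord_ext) (simp_all add: algebra_simps)

lemma cj_mult: "cj (z * w) = cj z * cj w"
  by (rule coord_ext) (simp_all add: algebra_simps)

lemma cj_emb [simp]: "cj (emb c) = emb c"
  by (rule coord_ext) simp_all

lemma cj_0 [simp]: "cj 0 = 0"
  using cj_emb[of 0] by simp

lemma cj_poly_at: "cj (poly_at smul P z) = poly_at smul P (cj z)"
  by (induction P) (auto simp: cj_add cj_mult)

definition nrm :: "'l \<Rightarrow> 'k" where "nrm z = cx z * cx z + tr * cx z * cy z + nm * cy z * cy z"

lemma mult_cj: "z * cj z = emb (nrm z)"
  by (rule coord_ext) (simp_all add: nrm_def algebra_simps)

lemma nrm_mult [simp]: "nrm (z * w) = nrm z * nrm w"
  by (simp add: nrm_def algebra_simps)

lemma nrm_emb [simp]: "nrm (emb c) = c * c"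
  by (simp add: nrm_def)

lemma nrm_1 [simp]: "nrm 1 = 1"
  using nrm_emb[of 1] by simp

text \<open>The mixed coefficient is expressed through values of the form, so bounds at e, f and e +
  f carry over to the whole lattice, even if 2 is not a unit.\<close>

lemma nrm_lincomb: "nrm (emb x * e + emb y * f)
    = x * x * nrm e + x * y * (nrm (e + f) - nrm e - nrm f) + y * y * nrm f"
  by (simp add: nrm_def algebra_simps)

lemma unit_iff_nrm: "(\<exists>w. z * w = 1) \<longleftrightarrow> nrm z \<noteq> 0"
proof
  assume "\<exists>w. z * w = 1"
  then obtain w where "z * w = 1" ..
  then have "nrm z * nrm w = 1" by (simp flip: nrm_mult)
  then show "nrm z \<noteq> 0" by auto
next
  assume h: "nrm z \<noteq> 0"
  have "z * (cj z * emb (inverse (nrm z))) = emb (nrm z) * emb (inverse (nrm z))"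
    by (simp add: mult_cj flip: mult.assoc)
  then show "\<exists>w. z * w = 1" using emb_inverse[OF h] by auto
qed

text \<open>The conjugate of \<Delta> is a root of the same monic polynomial, hence integral and
  thus a polynomial in \<Delta>. So trace and norm are scalars that are integral, and
  \<open>O\<^sub>K\<close> is integrally closed.\<close>

lemma tr_nm_integral: "tr \<in> O\<^sub>K" "nm \<in> O\<^sub>K"
proof -
  obtain P where P: "lead_coeff P = 1" "\<forall>i. coeff P i \<in> O\<^sub>K" "poly_at smul P \<Delta> = 0"
    using Delta_integral by (auto simp: integral_closure_def)
  have "poly_at smul P (cj \<Delta>) = 0" using P(3) by (simp flip: cj_poly_at)
  then have "cj \<Delta> \<in> integral_closure v smul" using P unfolding integral_closure_def by blast
  then obtain Q where Q: "cj \<Delta> = poly_at smul Q \<Delta>" "\<forall>i. coeff Q i \<in> O\<^sub>K"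
    by (auto simp: integral_closure_eq_adjoin adjoin_def)
  have "emb tr = \<Delta> + cj \<Delta>" by (rule coord_ext) simp_all
  also have "\<dots> = poly_at smul ([:0, 1:] + Q) \<Delta>" by (simp add: poly_at_add Q)
  finally have "emb tr \<in> integral_closure v smul"
    unfolding integral_closure_eq_adjoin adjoin_def using Q(2)
    by (auto intro!: exI[of _ "[:0, 1:] + Q"] simp: coeff_pCons split: nat.splits)
  then show "tr \<in> O\<^sub>K" by (simp add: emb_integral_iff)
  have "emb nm = \<Delta> * cj \<Delta>" by (rule coord_ext) simp_all
  also have "\<dots> = poly_at smul (pCons 0 Q) \<Delta>" by (simp add: Q)
  finally have "emb nm \<in> integral_closure v smul"
    unfolding integral_closure_eq_adjoin adjoin_def using Q(2)
    by (auto intro!: exI[of _ "pCons 0 Q"] simp: coeff_pCons split: nat.splits)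
  then show "nm \<in> O\<^sub>K" by (simp add: emb_integral_iff)
qed

section \<open>The orders and their lattices\<close>

abbreviation "OL \<equiv> integral_closure v smul"
abbreviation "ord \<equiv> quad_order v smul p \<Delta>"

lemma lat_1_iff: "z \<in> lat 1 (emb c * \<Delta>) \<longleftrightarrow> cx z \<in> O\<^sub>K \<and> (\<exists>y\<in>O\<^sub>K. cy z = y * c)"
proof
  assume "z \<in> lat 1 (emb c * \<Delta>)"
  then obtain x y where xy: "z = emb x * 1 + emb y * (emb c * \<Delta>)" "x \<in> O\<^sub>K" "y \<in> O\<^sub>K"
    unfolding lat_def by blast
  then have "z = emb x + emb (y * c) * \<Delta>" by (simp add: algebra_simps)
  then have "cx z = x \<and> cy z = y * c" by (rule coord_eqI)
  then show "cx z \<in> O\<^sub>K \<and> (\<exists>y\<in>O\<^sub>K. cy z = y * c)" using xy by auto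
next
  assume "cx z \<in> O\<^sub>K \<and> (\<exists>y\<in>O\<^sub>K. cy z = y * c)"
  then obtain y where y: "cx z \<in> O\<^sub>K" "y \<in> O\<^sub>K" "cy z = y * c" by blast
  have "z = emb (cx z) * 1 + emb y * (emb c * \<Delta>)"
    using coords[of z] unfolding y(3) by (simp add: algebra_simps)
  then show "z \<in> lat 1 (emb c * \<Delta>)" using lat_mem y by metis
qed

lemma ord_eq_lat: "ord k = lat 1 (emb (p ^ k) * \<Delta>)"
  unfolding quad_order_def lat_def by (simp add: smul_eq mult.assoc)

lemma ord_iff: "z \<in> ord k \<longleftrightarrow> cx z \<in> O\<^sub>K \<and> (\<exists>y\<in>O\<^sub>K. cy z = y * p ^ k)"
  unfolding ord_eq_lat lat_1_iff ..

lemma indep_1_mult_Delta: "c \<noteq> 0 \<Longrightarrow> indep 1 (emb c * \<Delta>)"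
  unfolding indep_1_iff
proof
  assume c: "c \<noteq> 0" and "emb c * \<Delta> \<in> range emb"
  then obtain d where "emb c * \<Delta> = emb d" by auto
  then have "cy (emb c * \<Delta>) = 0" by simp
  then show False using c by simp
qed

lemma lattice_ord: "lattice (ord k)"
  unfolding is_lattice_iff ord_eq_lat using indep_1_mult_Delta[of "p ^ k"] by auto

lemma lattice_mult_ord: "nrm z \<noteq> 0 \<Longrightarrow> lattice ((*) z ` ord k)"
  using lattice_mult[OF lattice_ord] unit_iff_nrm by blast

lemma ord_mult: "z \<in> ord k \<Longrightarrow> w \<in> ord k \<Longrightarrow> z * w \<in> ord k"
proof -
  assume "z \<in> ord k" "w \<in> ord k"
  then obtain y y' where h: "cx z \<in> O\<^sub>K" "cx w \<in> O\<^sub>K" "y \<in> O\<^sub>K" "y' \<in> O\<^sub>K"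
    "cy z = y * p ^ k" "cy w = y' * p ^ k" unfolding ord_iff by blast
  have "cy (z * w) = (cx z * y' + y * cx w + tr * y * (y' * p ^ k)) * p ^ k"
    by (simp add: h algebra_simps)
  moreover have "cx z * y' + y * cx w + tr * y * (y' * p ^ k) \<in> O\<^sub>K" using h tr_nm_integral by auto
  moreover have "cx (z * w) \<in> O\<^sub>K" using h tr_nm_integral by auto
  ultimately show ?thesis unfolding ord_iff by blast
qed

lemma one_in_ord: "1 \<in> ord k"
  unfolding ord_eq_lat by (rule lat_basis)

text \<open>Integrality of \<open>tr\<close> and \<open>nm\<close> closes \<open>ord 0\<close> under
  multiplication, so evaluating a polynomial at \<Delta> by Horner's scheme stays inside.\<close>

lemma OL_eq_ord_0: "OL = ord 0"
proof
  have "poly_at smul P \<Delta> \<in> ord 0" if "\<forall>i. coeff P i \<in> O\<^sub>K" for P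
    using that
  proof (induction P)
    case 0
    then show ?case using coord_emb[of 0] by (simp add: ord_iff)
  next
    case (pCons a P)
    have "a \<in> O\<^sub>K" "\<forall>i. coeff P i \<in> O\<^sub>K"
      using pCons.prems[rule_format, of 0] pCons.prems[rule_format, of "Suc _"] by auto
    then have "poly_at smul P \<Delta> \<in> ord 0" "emb a \<in> ord 0" using pCons.IH by (auto simp: ord_iff)
    moreover have "\<Delta> \<in> ord 0" by (auto simp: ord_iff)
    ultimately have "emb a + \<Delta> * poly_at smul P \<Delta> \<in> ord 0"
      using ord_mult O_submoduleD(3)[OF lattice_O_submodule[OF lattice_ord]] by blast
    then show ?case by simp
  qed
  then show "OL \<subseteq> ord 0" unfolding integral_closure_eq_adjoin adjoin_def by auto
  show "ord 0 \<subseteq> OL"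
  proof
    fix z assume "z \<in> ord 0"
    then have h: "cx z \<in> O\<^sub>K" "cy z \<in> O\<^sub>K" by (auto simp: ord_iff)
    have "z = poly_at smul [:cx z, cy z:] \<Delta>" using coords[of z] by (simp add: mult.commute)
    moreover have "\<forall>i. coeff [:cx z, cy z:] i \<in> O\<^sub>K"
      using h by (auto simp: coeff_pCons split: nat.splits)
    ultimately show "z \<in> OL" unfolding integral_closure_eq_adjoin adjoin_def by blast
  qed
qed

lemma OL_iff: "z \<in> OL \<longleftrightarrow> cx z \<in> O\<^sub>K \<and> cy z \<in> O\<^sub>K"
  unfolding OL_eq_ord_0 ord_iff by auto

lemma nrm_OL: "z \<in> OL \<Longrightarrow> nrm z \<in> O\<^sub>K"
  unfolding OL_iff nrm_def using tr_nm_integral by auto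

text \<open>The inverse is the conjugate divided by the norm, and conjugation preserves
  \<open>OL\<close> because \<open>tr\<close> is integral.\<close>

lemma OL_unit_iff:
  assumes "z \<in> OL"
  shows "(\<exists>y\<in>OL. z * y = 1) \<longleftrightarrow> nrm z \<noteq> 0 \<and> v (nrm z) = 0"
proof
  assume "\<exists>y\<in>OL. z * y = 1"
  then obtain y where y: "y \<in> OL" "z * y = 1" by blast
  then have eq: "nrm z * nrm y = 1" by (simp flip: nrm_mult)
  then have nz: "nrm z \<noteq> 0" "nrm y \<noteq> 0" by auto
  then have "v (nrm z) + v (nrm y) = 0" using val_mult[of "nrm z" "nrm y"] eq by simp
  then show "nrm z \<noteq> 0 \<and> v (nrm z) = 0"
    using nz nrm_OL[OF assms] nrm_OL[OF y(1)] by (auto simp: val_ring_iff)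
next
  assume h: "nrm z \<noteq> 0 \<and> v (nrm z) = 0"
  let ?y = "cj z * emb (inverse (nrm z))"
  have "z * ?y = emb (nrm z) * emb (inverse (nrm z))"
    by (simp add: mult_cj flip: mult.assoc)
  then have "z * ?y = 1" using emb_inverse h by simp
  moreover have "?y \<in> OL" using assms tr_nm_integral val_ring_unit[of "nrm z"] h
    unfolding OL_iff by auto
  ultimately show "\<exists>y\<in>OL. z * y = 1" by blast
qed

text \<open>The norm form of \<open>\<Lambda>\<close>, divided by its content, represents a unit (at one of \<open>e\<close>, \<open>f\<close>, \<open>e + f\<close>).
  Dividing \<open>\<Lambda>\<close> by an element \<open>z\<close> of minimal norm leaves a lattice \<open>O\<^sub>K + O\<^sub>K \<tau>\<close> with \<open>\<tau>\<close> integral.\<close>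

lemma lattice_structure:
  assumes "lattice \<Lambda>"
  obtains z k where "nrm z \<noteq> 0" "\<Lambda> = (*) z ` ord k"
proof -
  obtain e f where ef: "indep e f" "\<Lambda> = lat e f" using assms by (auto simp: is_lattice_iff)
  let ?S = "{x \<in> {e, f, e + f}. nrm x \<noteq> 0}"
  \<comment> \<open>If all three norms vanished, the form would vanish identically, contrary to the
    norm of 1.\<close>
  have "?S \<noteq> {}"
  proof
    assume "?S = {}"
    then have "nrm e = 0" "nrm f = 0" "nrm (e + f) = 0" by auto
    moreover obtain x y where "1 = emb x * e + emb y * f" using indep_span[OF ef(1)] .
    ultimately have "nrm 1 = 0" using nrm_lincomb[of x e y f] by simp
    then show False by simp
  qed
  then obtain z where "is_arg_min (\<lambda>x. v (nrm x)) (\<lambda>x. x \<in> ?S) z"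
    using ex_is_arg_min_if_finite[of ?S "\<lambda>x. v (nrm x)"] by auto
  then have z: "z \<in> ?S" and zmin: "\<And>x. x \<in> ?S \<Longrightarrow> v (nrm z) \<le> v (nrm x)"
    by (auto simp: is_arg_min_linorder)
  define \<mu> where "\<mu> = v (nrm z)"
  have nz: "nrm z \<noteq> 0" using z by simp
  have ge: "val_ge v (nrm e) \<mu>" "val_ge v (nrm f) \<mu>" "val_ge v (nrm (e + f)) \<mu>"
    using zmin by (auto simp: val_ge_def \<mu>_def)
  have zL: "z \<in> \<Lambda>"
    using z lat_basis(1)[of e f] lat_basis(2)[of f e] lat_mem[of 1 1 e f] by (auto simp: ef(2))
  have all: "val_ge v (nrm x) \<mu>" if "x \<in> \<Lambda>" for x
  proof -
    obtain a b where ab: "x = emb a * e + emb b * f" "a \<in> O\<^sub>K" "b \<in> O\<^sub>K"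
      using \<open>x \<in> \<Lambda>\<close> unfolding ef(2) lat_def by blast
    have mul: "val_ge v (c * y) \<mu>" if "c \<in> O\<^sub>K" "val_ge v y \<mu>" for c y
      using val_ge_mult[of c 0 y \<mu>] that by (simp add: val_ring_def)
    have "val_ge v (nrm (e + f) + - nrm e + - nrm f) \<mu>" by (intro val_ge_add val_ge_uminus ge)
    then have "val_ge v (nrm (e + f) - nrm e - nrm f) \<mu>" by simp
    then show ?thesis unfolding ab(1) nrm_lincomb using ab ge by (intro val_ge_add mul) auto
  qed
  have quot: "c / nrm z \<in> O\<^sub>K" if "val_ge v c \<mu>" for c
    using val_ring_divide[OF nz, of c] that by (auto simp: val_ge_def \<mu>_def)
  \<comment> \<open>Otherwise z / p would be an element of \<Lambda> whose norm has valuation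
    smaller by 2.\<close>
  have "z \<notin> smul p ` \<Lambda>"
  proof
    assume "z \<in> smul p ` \<Lambda>"
    then obtain y where y: "y \<in> \<Lambda>" "z = emb p * y" by (auto simp: smul_eq)
    then have "nrm z = p * p * nrm y" by simp
    then have "nrm y \<noteq> 0" "v (nrm z) = 2 + v (nrm y)" using nz by (auto simp: val_mult)
    then show False using all[OF y(1)] by (auto simp: val_ge_def \<mu>_def)
  qed
  then obtain g where g: "indep z g" "\<Lambda> = lat z g" using lattice_extend_basis[OF assms zL] by blast
  obtain w where w: "z * w = 1" using nz unit_iff_nrm by blast
  define \<tau> where "\<tau> = w * g"
  have g_eq: "g = z * \<tau>" using w by (simp add: \<tau>_def flip: mult.assoc)
  have n1: "nrm \<tau> = nrm g / nrm z" using nz by (simp add: g_eq)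
  have "z + g = z * (1 + \<tau>)" by (simp add: g_eq algebra_simps)
  then have n2: "nrm (1 + \<tau>) = nrm (z + g) / nrm z" using nz by simp
  have gL: "g \<in> \<Lambda>" "z + g \<in> \<Lambda>" using lat_basis lat_mem[of 1 1 z g] by (auto simp: g(2))
  have i1: "nrm \<tau> \<in> O\<^sub>K" "nrm (1 + \<tau>) \<in> O\<^sub>K" unfolding n1 n2 using quot all gL by auto
  \<comment> \<open>The quadratic equation of \<tau>, with its trace written as a difference of
    norms, which are already known to be integral.\<close>
  have eq: "\<tau> * \<tau> = emb (nrm (1 + \<tau>) - 1 - nrm \<tau>) * \<tau> - emb (nrm \<tau>)"
  proof -
    have "\<tau> * \<tau> + emb (nrm \<tau>) = emb (nrm (1 + \<tau>) - 1 - nrm \<tau>) * \<tau>"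
    proof (rule coord_ext)
      have c1: "cx 1 = 1" "cy 1 = 0" using coord_emb[of 1] by simp_all
      show "cx (\<tau> * \<tau> + emb (nrm \<tau>)) = cx (emb (nrm (1 + \<tau>) - 1 - nrm \<tau>) * \<tau>)"
        unfolding coord_add coord_mult coord_emb by (simp add: nrm_def c1 algebra_simps)
      show "cy (\<tau> * \<tau> + emb (nrm \<tau>)) = cy (emb (nrm (1 + \<tau>) - 1 - nrm \<tau>) * \<tau>)"
        unfolding coord_add coord_mult coord_emb by (simp add: nrm_def c1 algebra_simps)
    qed
    then show ?thesis by (metis add_diff_cancel_right')
  qed
  have "\<tau> \<in> OL" by (rule quadratic_integral[OF eq]) (use i1 in auto)
  then have xy: "cx \<tau> \<in> O\<^sub>K" "cy \<tau> \<in> O\<^sub>K" by (auto simp: OL_iff)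
  have y0: "cy \<tau> \<noteq> 0"
  proof
    assume "cy \<tau> = 0"
    then have "\<tau> = emb (cx \<tau>)" using coords[of \<tau>] by simp
    then have "emb (cx \<tau>) * z + emb (-1) * g = 0" by (simp add: g_eq mult.commute)
    then show False using indepD[OF g(1)] by fastforce
  qed
  \<comment> \<open>Modulo \<open>O\<^sub>K\<close>, \<tau> equals a unit times p^k \<Delta>; this
    valuation is therefore the conductor exponent.\<close>
  define k where "k = nat (v (cy \<tau>))"
  define u where "u = cy \<tau> / p ^ k"
  have cyu: "cy \<tau> = u * p ^ k" by (simp add: u_def)
  have u: "u \<noteq> 0" "v u = 0"
  proof -
    show "u \<noteq> 0" using y0 by (simp add: u_def)
    then have "v (cy \<tau>) = v u + int k" using val_mult[of u "p ^ k"] by (simp add: cyu)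
    then show "v u = 0" using xy(2) y0 by (simp add: k_def val_ring_iff)
  qed
  have uO: "u \<in> O\<^sub>K" "inverse u \<in> O\<^sub>K" using val_ring_unit u by auto
  have "lat 1 \<tau> = ord k"
  proof
    have "\<tau> \<in> ord k" unfolding ord_iff cyu using xy uO by blast
    then show "lat 1 \<tau> \<subseteq> ord k"
      using one_in_ord by (simp add: lat_subset_iff lattice_O_submodule lattice_ord)
    have "emb (p ^ k) * \<Delta> = emb (- inverse u * cx \<tau>) * 1 + emb (inverse u) * \<tau>"
    proof (rule coord_ext)
      show "cx (emb (p ^ k) * \<Delta>) = cx (emb (- inverse u * cx \<tau>) * 1 + emb (inverse u) * \<tau>)"
        unfolding mult_1_right coord_add coord_mult coord_emb coord_Delta by simp
      show "cy (emb (p ^ k) * \<Delta>) = cy (emb (- inverse u * cx \<tau>) * 1 + emb (inverse u) * \<tau>)"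
        unfolding mult_1_right coord_add coord_mult coord_emb coord_Delta cyu using u by simp
    qed
    then have "emb (p ^ k) * \<Delta> \<in> lat 1 \<tau>" using lat_mem[of "- inverse u * cx \<tau>" "inverse u" 1 \<tau>] uO xy
      by auto
    then show "ord k \<subseteq> lat 1 \<tau>" unfolding ord_eq_lat
      by (simp only: lat_subset_iff[OF O_submodule_lat] lat_basis simp_thms)
  qed
  then have "\<Lambda> = (*) z ` ord k" using image_mult_lat[of z 1 \<tau>] by (simp add: g(2) g_eq)
  then show ?thesis using that nz by blast
qed

end

subsection \<open>Layers and the basin\<close>

context monogenic_quadratic_algebra
begin

text \<open>For a lattice this says that \<open>ord m\<close> lies in its multiplier ring. It
  involves no choice of a presentation z \<open>ord k\<close> and is monotone in m on lattices, so
  \<open>T m\<close> is directly a candidate for the m-th thickening.\<close>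

definition stab :: "nat \<Rightarrow> 'l set \<Rightarrow> bool" where
  "stab m \<Lambda> \<longleftrightarrow> (*) (emb (p ^ m) * \<Delta>) ` \<Lambda> \<subseteq> \<Lambda>"

definition T :: "nat \<Rightarrow> 'l set set set" where
  "T m = {cls \<Lambda> | \<Lambda>. lattice \<Lambda> \<and> stab m \<Lambda>}"

lemma stab_mult:
  assumes "z * w = 1"
  shows "stab m ((*) z ` \<Lambda>) \<longleftrightarrow> stab m \<Lambda>"
proof -
  have "(*) a ` ((*) z ` \<Lambda>) = (*) z ` ((*) a ` \<Lambda>)" for a
    unfolding image_mult_image by (simp only: mult.commute)
  then show ?thesis unfolding stab_def by (simp only: image_mult_unit_subset_iff[OF assms])
qed

lemma cls_in_T_iff: "lattice \<Lambda> \<Longrightarrow> cls \<Lambda> \<in> T m \<longleftrightarrow> stab m \<Lambda>"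
proof
  assume "cls \<Lambda> \<in> T m"
  then obtain M where M: "cls \<Lambda> = cls M" "stab m M" by (auto simp: T_def)
  then obtain c where c: "c \<noteq> 0" "M = smul c ` \<Lambda>" using cls_eqD by metis
  then show "stab m \<Lambda>" using M(2) stab_mult[OF emb_inverse[OF c(1)]] by (simp add: image_smul)
qed (auto simp: T_def)

text \<open>Since \<open>ord k\<close> is a ring containing 1, stability amounts to p^m \<Delta>
  being an element of it.\<close>

lemma stab_ord_iff: "stab m (ord k) \<longleftrightarrow> k \<le> m"
proof
  assume "stab m (ord k)"
  then have "emb (p ^ m) * \<Delta> * 1 \<in> ord k" using one_in_ord unfolding stab_def by blast
  then have "emb (p ^ m) * \<Delta> \<in> ord k" by simp
  moreover have "cy (emb (p ^ m) * \<Delta>) = p ^ m" unfolding coord_mult coord_emb coord_Delta by simp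
  ultimately obtain y where y: "y \<in> O\<^sub>K" "p ^ m = y * p ^ k" unfolding ord_iff by auto
  then have "y \<noteq> 0" by auto
  then have "int m = v y + int k" using val_mult[of y "p ^ k"] y(2)[symmetric] by simp
  then show "k \<le> m" using y(1) \<open>y \<noteq> 0\<close> by (simp add: val_ring_iff)
next
  assume "k \<le> m"
  then have "p ^ m = p ^ (m - k) * p ^ k" by (simp flip: power_add)
  moreover have "cy (emb (p ^ m) * \<Delta>) = p ^ m" "cx (emb (p ^ m) * \<Delta>) = 0"
    unfolding coord_mult coord_emb coord_Delta by simp_all
  ultimately have "emb (p ^ m) * \<Delta> \<in> ord k" unfolding ord_iff
    by (metis p_in_val_ring val_ring_closed(1,7))
  then show "stab m (ord k)" unfolding stab_def using ord_mult by blast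
qed

lemma cls_mult_ord_in_T_iff: "nrm z \<noteq> 0 \<Longrightarrow> cls ((*) z ` ord k) \<in> T m \<longleftrightarrow> k \<le> m"
  using cls_in_T_iff[OF lattice_mult_ord] stab_mult stab_ord_iff unit_iff_nrm by metis

lemma T_iff: "x \<in> T m \<longleftrightarrow> (\<exists>z k. nrm z \<noteq> 0 \<and> k \<le> m \<and> x = cls ((*) z ` ord k))"
proof
  assume x: "x \<in> T m"
  then obtain \<Lambda> where "lattice \<Lambda>" "x = cls \<Lambda>" by (auto simp: T_def)
  moreover obtain z k where "nrm z \<noteq> 0" "\<Lambda> = (*) z ` ord k" using lattice_structure[OF \<open>lattice \<Lambda>\<close>] .
  ultimately show "\<exists>z k. nrm z \<noteq> 0 \<and> k \<le> m \<and> x = cls ((*) z ` ord k)"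
    using x cls_mult_ord_in_T_iff by blast
next
  assume "\<exists>z k. nrm z \<noteq> 0 \<and> k \<le> m \<and> x = cls ((*) z ` ord k)"
  then show "x \<in> T m" using cls_mult_ord_in_T_iff by blast
qed

lemma T_0_iff: "x \<in> T 0 \<longleftrightarrow> (\<exists>z. nrm z \<noteq> 0 \<and> x = cls ((*) z ` OL))"
  by (simp add: T_iff OL_eq_ord_0)

lemma step_mult_ord:
  assumes "nrm z \<noteq> 0"
  shows "((*) z ` ord k, (*) z ` ord (Suc k)) \<in> step"
proof -
  obtain w where w: "z * w = 1" using assms unit_iff_nrm by blast
  have "indep (z * 1) (z * (emb (p ^ k) * \<Delta>))"
    using indep_mult[OF indep_1_mult_Delta w, of "p ^ k"] by simp
  from step_lat[OF this] show ?thesis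
    unfolding ord_eq_lat image_mult_lat by (simp add: algebra_simps)
qed

lemma T_subset_V: "T m \<subseteq> V"
  by (auto simp: T_def vertex_iff)

lemma T_mono: "T m \<subseteq> T (Suc m)"
  unfolding subset_iff T_iff using le_SucI by blast

lemma T_nonempty: "T 0 \<noteq> {}"
proof -
  have "cls ((*) 1 ` OL) \<in> T 0" unfolding T_0_iff by (rule exI[of _ 1]) simp
  then show ?thesis by blast
qed

text \<open>For a in \<Lambda>' the product p^m \<Delta> a lies in \<Lambda>, and one more factor p
  brings it into p \<Lambda>, which is contained in \<Lambda>'.\<close>

lemma T_neighbour_up: "y \<in> T m \<Longrightarrow> (x, y) \<in> E \<Longrightarrow> x \<in> T (Suc m)"
proof -
  assume y: "y \<in> T m" and e: "(x, y) \<in> E"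
  then obtain \<Lambda> where L: "lattice \<Lambda>" "stab m \<Lambda>" "y = cls \<Lambda>" by (auto simp: T_def)
  then obtain \<Lambda>' where L': "(\<Lambda>, \<Lambda>') \<in> step" "x = cls \<Lambda>'" using edge_iff edge_sym[OF e] by auto
  then have sub: "smul p ` \<Lambda> \<subseteq> \<Lambda>'" "\<Lambda>' \<subseteq> \<Lambda>" "lattice \<Lambda>'" by (auto simp: step_def)
  have "emb (p ^ Suc m) * \<Delta> * a \<in> \<Lambda>'" if "a \<in> \<Lambda>'" for a
  proof -
    have "emb (p ^ m) * \<Delta> * a \<in> \<Lambda>" using L(2) that sub unfolding stab_def by blast
    then have "smul p (emb (p ^ m) * \<Delta> * a) \<in> \<Lambda>'" using sub by blast
    then show ?thesis by (simp add: smul_eq mult.assoc)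
  qed
  then show ?thesis using sub L' unfolding T_def stab_def by auto
qed

text \<open>Such a vertex has exact conductor exponent m + 1; keeping z and enlarging the order to
  \<open>ord m\<close> gives the neighbour.\<close>

lemma T_neighbour_down: "x \<in> T (Suc m) \<Longrightarrow> x \<notin> T m \<Longrightarrow> \<exists>y\<in>T m. (x, y) \<in> E"
proof -
  assume x: "x \<in> T (Suc m)" "x \<notin> T m"
  then obtain z k where z: "nrm z \<noteq> 0" "k \<le> Suc m" "x = cls ((*) z ` ord k)"
    unfolding T_iff by blast
  then have "k = Suc m" using x(2) cls_mult_ord_in_T_iff le_SucE by blast
  then have "(cls ((*) z ` ord m), x) \<in> E"
    using edge_iff[OF lattice_mult_ord[OF z(1)]] step_mult_ord[OF z(1)] z(3) by blast
  moreover have "cls ((*) z ` ord m) \<in> T m" using cls_mult_ord_in_T_iff z by simp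
  ultimately show ?thesis using edge_sym by blast
qed

lemma thick_T: "thick V E (T 0) m = T m"
  by (rule thick_eqI[OF tree_connected T_subset_V T_nonempty T_mono])
    (use T_neighbour_up T_neighbour_down in blast)+

lemma layer_T_iff: "x \<in> layer V E (T 0) m \<longleftrightarrow> (\<exists>z. nrm z \<noteq> 0 \<and> x = cls ((*) z ` ord m))"
  unfolding layer_eqI[OF thick_T T_mono]
proof
  assume x: "x \<in> T m \<and> (\<forall>k<m. x \<notin> T k)"
  then obtain z k where z: "nrm z \<noteq> 0" "k \<le> m" "x = cls ((*) z ` ord k)"
    unfolding T_iff by blast
  then have "x \<in> T k" using cls_mult_ord_in_T_iff by simp
  then have "k = m" using x z(2) by (meson le_neq_implies_less)
  then show "\<exists>z. nrm z \<noteq> 0 \<and> x = cls ((*) z ` ord m)" using z by blast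
next
  assume "\<exists>z. nrm z \<noteq> 0 \<and> x = cls ((*) z ` ord m)"
  then show "x \<in> T m \<and> (\<forall>k<m. x \<notin> T k)" using cls_mult_ord_in_T_iff by auto
qed

lemma height_ord: "height V E (T 0) (cls (ord m)) = m"
  using cls_mult_ord_in_T_iff[of 1] by (intro height_eqI[OF thick_T T_mono]) auto

section \<open>The basin when L is a field\<close>

lemma cls_mult_emb: "c \<noteq> 0 \<Longrightarrow> cls ((*) (emb c * z) ` \<Lambda>) = cls ((*) z ` \<Lambda>)"
  using cls_smul[of c "(*) z ` \<Lambda>"] by (simp add: image_smul image_mult_image)

lemma OL_mult: "z \<in> OL \<Longrightarrow> w \<in> OL \<Longrightarrow> z * w \<in> OL"
  unfolding OL_eq_ord_0 by (rule ord_mult)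

lemma one_in_OL: "1 \<in> OL"
  unfolding OL_eq_ord_0 by (rule one_in_ord)

lemma image_mult_OL_unit:
  assumes "z \<in> OL" "y \<in> OL" "z * y = 1"
  shows "(*) z ` OL = OL"
proof
  show "(*) z ` OL \<subseteq> OL" using OL_mult assms by auto
  show "OL \<subseteq> (*) z ` OL"
  proof
    fix x assume "x \<in> OL"
    then have "y * x \<in> OL" "x = z * (y * x)" using OL_mult assms by (auto simp flip: mult.assoc)
    then show "x \<in> (*) z ` OL" by blast
  qed
qed

text \<open>Dividing by the coordinate of smaller valuation makes that coordinate 1 and keeps the
  other one integral.\<close>

lemma OL_primitive_multiple:
  assumes "z \<noteq> 0"
  obtains c where "c \<noteq> 0" "emb c * z \<in> OL" "emb c * z \<notin> (*) (emb p) ` OL"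
proof -
  have prim: "w \<notin> (*) (emb p) ` OL" if h: "cx w = 1 \<or> cy w = 1" for w
  proof
    assume "w \<in> (*) (emb p) ` OL"
    then obtain y where y: "y \<in> OL" "w = emb p * y" by auto
    then have "cx w = p * cx y" "cy w = p * cy y" by simp_all
    then obtain a where a: "a \<in> O\<^sub>K" "p * a = 1" using h y(1) by (auto simp: OL_iff)
    then have "a \<noteq> 0" by auto
    then have "v (p * a) = 1 + v a" using val_mult[of p a] by simp
    then show False using a \<open>a \<noteq> 0\<close> by (simp add: val_ring_iff)
  qed
  have nz: "cx z \<noteq> 0 \<or> cy z \<noteq> 0" using coords[of z] assms by auto
  have cc: "cx (emb c * z) = c * cx z" "cy (emb c * z) = c * cy z" for c by simp_all
  show ?thesis
  proof (cases "cx z \<noteq> 0 \<and> (cy z = 0 \<or> v (cx z) \<le> v (cy z))")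
    case True
    let ?c = "inverse (cx z)"
    have "cy z / cx z \<in> O\<^sub>K" using True by (intro val_ring_divide) auto
    then have "cx (emb ?c * z) = 1" "cy (emb ?c * z) \<in> O\<^sub>K"
      unfolding cc using True by (simp_all add: field_simps)
    then show ?thesis using prim True by (intro that[of ?c]) (auto simp: OL_iff simp del: coord_mult)
  next
    case False
    then have h: "cy z \<noteq> 0" "cx z = 0 \<or> v (cy z) \<le> v (cx z)" using nz by auto
    let ?c = "inverse (cy z)"
    have "cx z / cy z \<in> O\<^sub>K" using h by (intro val_ring_divide) auto
    then have "cy (emb ?c * z) = 1" "cx (emb ?c * z) \<in> O\<^sub>K"
      unfolding cc using h by (simp_all add: field_simps)
    then show ?thesis using prim h by (intro that[of ?c]) (auto simp: OL_iff simp del: coord_mult)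
  qed
qed

text \<open>When p generates the non-units, a primitive element of \<open>OL\<close> is a unit, so
  every fractional ideal z \<open>OL\<close> is homothetic to \<open>OL\<close>.\<close>

lemma T_0_unramified:
  assumes "is_uniformizer v smul (smul p 1)"
  shows "T 0 = {cls OL}"
proof -
  have unif: "(*) (emb p) ` OL = {x \<in> OL. \<not> (\<exists>y\<in>OL. x * y = 1)}"
    using assms by (simp add: is_uniformizer_def emb_def Let_def)
  have "cls ((*) z ` OL) = cls OL" if "nrm z \<noteq> 0" for z
  proof -
    have "z \<noteq> 0" using that nrm_emb[of 0] by auto
    then obtain c where c: "c \<noteq> 0" "emb c * z \<in> OL" "emb c * z \<notin> (*) (emb p) ` OL"
      using OL_primitive_multiple by blast
    then obtain y where "y \<in> OL" "emb c * z * y = 1" using unif by auto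
    then have "(*) (emb c * z) ` OL = OL" using image_mult_OL_unit c by blast
    then show ?thesis using cls_mult_emb[OF c(1), of z OL] by simp
  qed
  moreover have "nrm 1 \<noteq> 0" by simp
  ultimately show ?thesis unfolding set_eq_iff T_0_iff by blast
qed

text \<open>The square of \<pi> is p times a unit, so a primitive element is a unit or \<pi> times a
  unit.\<close>

lemma T_0_ramified:
  assumes nunif: "\<not> is_uniformizer v smul (smul p 1)" and unif: "is_uniformizer v smul \<pi>"
  shows "T 0 = {cls OL, cls ((*) \<pi> ` OL)}"
proof -
  have pi: "\<pi> \<in> OL" "(*) \<pi> ` OL = {x \<in> OL. \<not> (\<exists>y\<in>OL. x * y = 1)}"
    using unif by (auto simp: is_uniformizer_def Let_def)
  have nonunit: "\<exists>y\<in>OL. x = \<pi> * y" if "x \<in> OL" "\<not> (\<exists>y\<in>OL. x * y = 1)" for x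
    using pi(2) that by blast
  have p_OL: "emb p \<in> OL" by (simp add: OL_iff)
  have p_nonunit: "\<not> (\<exists>y\<in>OL. emb p * y = 1)"
    unfolding OL_unit_iff[OF p_OL] by (simp add: val_mult)
  obtain y where y: "y \<in> OL" "emb p = \<pi> * y" using nonunit[OF p_OL p_nonunit] by blast
  \<comment> \<open>If y were a unit, p and \<pi> would generate the same ideal and p would be a
    uniformizer.\<close>
  have "\<not> (\<exists>x\<in>OL. y * x = 1)"
  proof
    assume "\<exists>x\<in>OL. y * x = 1"
    then have "(*) y ` OL = OL" using image_mult_OL_unit y by blast
    then have "(*) (emb p) ` OL = (*) \<pi> ` OL" unfolding y(2) by (metis image_mult_image)
    then have "is_uniformizer v smul (smul p 1)"
      using pi(2) p_OL by (simp add: is_uniformizer_def emb_def Let_def)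
    then show False using nunif by blast
  qed
  then obtain y' where y': "y' \<in> OL" "y = \<pi> * y'" using nonunit y by blast
  have pp: "emb p = \<pi> * \<pi> * y'" using y y' by (simp add: mult.assoc)
  \<comment> \<open>Comparing valuations of norms: the left side has valuation 2 and each factor
    \<open>nrm \<pi>\<close> contributes at least 1, which leaves 0 for y'.\<close>
  then have nn: "p * p = nrm \<pi> * nrm \<pi> * nrm y'" by (metis nrm_emb nrm_mult)
  then have nz: "nrm \<pi> \<noteq> 0" "nrm y' \<noteq> 0" by auto
  have "\<pi> * 1 \<in> (*) \<pi> ` OL" using one_in_OL by blast
  then have "\<not> (\<exists>x\<in>OL. \<pi> * x = 1)" using pi(2) by simp
  then have "v (nrm \<pi>) \<noteq> 0" using OL_unit_iff pi(1) nz by blast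
  then have "v (nrm \<pi>) \<ge> 1" using nrm_OL[OF pi(1)] nz by (simp add: val_ring_iff)
  moreover have "v (nrm y') \<ge> 0" using nrm_OL[OF y'(1)] nz by (simp add: val_ring_iff)
  moreover have "2 = v (nrm \<pi>) + v (nrm \<pi>) + v (nrm y')"
    using arg_cong[OF nn, of v] nz by (simp add: val_mult)
  ultimately have "v (nrm y') = 0" by simp
  then obtain u where u: "u \<in> OL" "y' * u = 1" using OL_unit_iff y' nz by blast
  have pi2: "\<pi> * \<pi> = emb p * u" using u(2) by (simp add: pp mult.assoc)
  have "cls ((*) z ` OL) \<in> {cls OL, cls ((*) \<pi> ` OL)}" if "nrm z \<noteq> 0" for z
  proof -
    have "z \<noteq> 0" using that nrm_emb[of 0] by auto
    then obtain c where c: "c \<noteq> 0" "emb c * z \<in> OL" "emb c * z \<notin> (*) (emb p) ` OL"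
      using OL_primitive_multiple by blast
    let ?w = "emb c * z"
    have cw: "cls ((*) z ` OL) = cls ((*) ?w ` OL)" using cls_mult_emb[OF c(1)] by simp
    show ?thesis
    proof (cases "\<exists>y\<in>OL. ?w * y = 1")
      case True
      then have "(*) ?w ` OL = OL" using image_mult_OL_unit c by blast
      then show ?thesis using cw by simp
    next
      case False
      then obtain a where a: "a \<in> OL" "?w = \<pi> * a" using nonunit c by blast
      have "\<exists>b\<in>OL. a * b = 1"
      proof (rule ccontr)
        assume "\<not> (\<exists>b\<in>OL. a * b = 1)"
        then obtain b where b: "b \<in> OL" "a = \<pi> * b" using nonunit a by blast
        then have "?w = emb p * (u * b)" using a(2) pi2 by (simp flip: mult.assoc)
        then show False using c(3) OL_mult u b by blast
      qed
      then have "(*) a ` OL = OL" using image_mult_OL_unit a by blast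
      then have "(*) ?w ` OL = (*) \<pi> ` OL" unfolding a(2) by (metis image_mult_image)
      then show ?thesis using cw by simp
    qed
  qed
  then have "T 0 \<subseteq> {cls OL, cls ((*) \<pi> ` OL)}" unfolding T_0_iff subset_iff by blast
  moreover have "cls ((*) 1 ` OL) \<in> T 0" unfolding T_0_iff by (rule exI[of _ 1]) simp
  then have "cls OL \<in> T 0" by simp
  moreover have "cls ((*) \<pi> ` OL) \<in> T 0" unfolding T_0_iff using nz(1) by blast
  ultimately show ?thesis by blast
qed

text \<open>In a non-field some \<open>x \<noteq> 0\<close> has norm \<open>0\<close>, so that \<open>x\<^sup>2 = t x\<close> where \<open>t\<close> is the trace;
  \<open>t \<noteq> 0\<close> as \<open>L\<close> is reduced, and \<open>x / t\<close> is a nontrivial idempotent.\<close>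

lemma non_field_is_split:
  assumes "\<not> (\<forall>x::'l. x \<noteq> 0 \<longrightarrow> (\<exists>y. x * y = 1))"
  shows "is_split smul"
proof -
  obtain x :: 'l where x: "x \<noteq> 0" "\<nexists>y. x * y = 1" using assms by blast
  then have n0: "nrm x = 0" using unit_iff_nrm by blast
  define t where "t = 2 * cx x + tr * cy x"
  have "x + cj x = emb t" by (rule coord_ext) (simp_all add: t_def)
  then have "x * (x + cj x) = emb t * x" by (simp add: mult.commute)
  then have xx: "x * x = emb t * x" using mult_cj[of x] n0 by (simp add: distrib_left)
  have t: "t \<noteq> 0"
  proof
    assume "t = 0"
    then have "x ^ 2 = 0" using xx by (simp add: power2_eq_square)
    then show False using reduced x by blast
  qed
  define e where "e = emb (inverse t) * x"
  have "e * e = emb (inverse t) * emb (inverse t) * (x * x)" by (simp add: e_def algebra_simps)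
  also have "\<dots> = emb t * emb (inverse t) * e" unfolding xx by (simp add: e_def algebra_simps)
  finally have ee: "e * e = e" using emb_inverse[OF t] by simp
  have e0: "e \<noteq> 0" using emb_cancel[of "inverse t" x 0] t x(1) by (auto simp: e_def)
  have e1: "1 - e \<noteq> 0"
  proof
    assume "1 - e = 0"
    then have "x * emb (inverse t) = 1" by (simp add: e_def mult.commute)
    then show False using x by blast
  qed
  define f where "f = 1 - e"
  have ff: "f * f = f" "e * f = 0" "f * e = 0" "e + f = 1" using ee by (simp_all add: f_def algebra_simps)
  have ind: "indep e f" unfolding indep_def
  proof (intro allI impI)
    fix a b assume h: "emb a * e + emb b * f = 0"
    then have "(emb a * e + emb b * f) * e = 0" "(emb a * e + emb b * f) * f = 0" by simp_all
    then have "emb a * e = 0" "emb b * f = 0" using ee ff by (simp_all add: distrib_right mult.assoc)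
    then show "a = 0 \<and> b = 0" using emb_cancel[of a e 0] emb_cancel[of b f 0] e0 e1 by (auto simp: f_def)
  qed
  define \<phi> where "\<phi> z = (THE ab. z = emb (fst ab) * e + emb (snd ab) * f)" for z
  have phi: "\<phi> (emb a * e + emb b * f) = (a, b)" for a b
    unfolding \<phi>_def
  proof (rule the_equality)
    fix ab assume "emb a * e + emb b * f = emb (fst ab) * e + emb (snd ab) * f"
    then have "a = fst ab \<and> b = snd ab" using indep_unique[OF ind] by blast
    then show "ab = (a, b)" by auto
  qed simp
  have rep: "z = emb (fst (\<phi> z)) * e + emb (snd (\<phi> z)) * f" for z
  proof -
    obtain a b where z: "z = emb a * e + emb b * f" using indep_span[OF ind] .
    show ?thesis unfolding z phi by simp
  qed
  have "splitting smul \<phi>"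
    unfolding splitting_def
  proof (intro conjI allI)
    show "bij \<phi>"
    proof (rule bijI)
      show "inj \<phi>" by (rule injI) (metis rep)
      show "surj \<phi>" by (rule surjI[of _ "\<lambda>(a, b). emb a * e + emb b * f"]) (auto simp: phi)
    qed
    show "\<phi> 1 = (1, 1)" using phi[of 1 1] ff(4) by simp
    fix z w :: 'l and c
    obtain a b where z: "z = emb a * e + emb b * f" using indep_span[OF ind] .
    obtain a' b' where w: "w = emb a' * e + emb b' * f" using indep_span[OF ind] .
    have "z + w = emb (a + a') * e + emb (b + b') * f" by (simp add: z w algebra_simps)
    then show "\<phi> (z + w) = (fst (\<phi> z) + fst (\<phi> w), snd (\<phi> z) + snd (\<phi> w))"
      unfolding z w phi by (simp only: phi fst_conv snd_conv)
    have "z * w = emb a * emb a' * (e * e) + emb b * emb b' * (f * f)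
        + (emb a * emb b' + emb b * emb a') * (e * f)" by (simp add: z w algebra_simps)
    then have "z * w = emb (a * a') * e + emb (b * b') * f" unfolding ee ff by simp
    then show "\<phi> (z * w) = (fst (\<phi> z) * fst (\<phi> w), snd (\<phi> z) * snd (\<phi> w))"
      unfolding z w phi by (simp only: phi fst_conv snd_conv)
    have "smul c z = emb (c * a) * e + emb (c * b) * f" by (simp add: z smul_eq algebra_simps)
    then show "\<phi> (smul c z) = (c * fst (\<phi> z), c * snd (\<phi> z))"
      unfolding z phi by (simp only: phi fst_conv snd_conv)
  qed
  then show ?thesis unfolding is_split_def by blast
qed

end

section \<open>The basin in the split case\<close>

context local_quadratic_algebra
begin

lemma image_mult_val_ring: "c \<noteq> 0 \<Longrightarrow> (\<lambda>x. c * x) ` O\<^sub>K = {x. val_ge v x (v c)}"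
proof (intro set_eqI iffI)
  fix x assume c: "c \<noteq> 0" and "x \<in> (\<lambda>x. c * x) ` O\<^sub>K"
  then obtain y where "y \<in> O\<^sub>K" "x = c * y" by blast
  then show "x \<in> {x. val_ge v x (v c)}" using c
    by (cases "y = 0") (auto simp: val_ge_def val_ring_iff val_mult)
next
  fix x assume c: "c \<noteq> 0" and "x \<in> {x. val_ge v x (v c)}"
  then have "x / c \<in> O\<^sub>K" by (intro val_ring_divide) (auto simp: val_ge_def)
  then show "x \<in> (\<lambda>x. c * x) ` O\<^sub>K" using c by (intro image_eqI[of _ _ "x / c"]) auto
qed

end

context monogenic_quadratic_algebra
begin

context
  fixes \<phi> :: "'l \<Rightarrow> 'k \<times> 'k"
  assumes splitting: "splitting smul \<phi>"
begin

abbreviation "f1 z \<equiv> fst (\<phi> z)"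
abbreviation "f2 z \<equiv> snd (\<phi> z)"

lemma split_eqI: "f1 z = f1 w \<Longrightarrow> f2 z = f2 w \<Longrightarrow> z = w"
proof -
  assume "f1 z = f1 w" "f2 z = f2 w"
  then have "\<phi> z = \<phi> w" by (rule prod_eqI)
  moreover have "inj \<phi>" using splitting by (simp add: splitting_def bij_def)
  ultimately show "z = w" by (simp add: injD)
qed

lemma split_surj: obtains z where "f1 z = a" "f2 z = b"
proof -
  have "surj \<phi>" using splitting by (auto simp: splitting_def bij_def)
  then obtain z where "\<phi> z = (a, b)" by (metis surjD)
  then show ?thesis using that[of z] by simp
qed

lemma split_hom: "f1 (z + w) = f1 z + f1 w" "f2 (z + w) = f2 z + f2 w"
  "f1 (z * w) = f1 z * f1 w" "f2 (z * w) = f2 z * f2 w"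
  "f1 1 = 1" "f2 1 = 1" "f1 (emb c) = c" "f2 (emb c) = c"
  using splitting by (auto simp: splitting_def emb_def)

lemma split_0: "f1 0 = 0" "f2 0 = 0"
  using split_hom(7,8)[of 0] by simp_all

lemma split_poly_at: "f1 (poly_at smul P z) = poly P (f1 z)" "f2 (poly_at smul P z) = poly P (f2 z)"
  by (induction P) (auto simp: split_hom split_0)

text \<open>Conversely to projecting a monic equation to both factors, z is a root of (X -
  \<open>f1 z\<close>)(X - \<open>f2 z\<close>).\<close>

lemma OL_split_iff: "z \<in> OL \<longleftrightarrow> f1 z \<in> O\<^sub>K \<and> f2 z \<in> O\<^sub>K"
proof
  assume "z \<in> OL"
  then obtain P where P: "lead_coeff P = 1" "\<forall>i. coeff P i \<in> O\<^sub>K" "poly_at smul P z = 0"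
    by (auto simp: integral_closure_def)
  have "poly P (f1 z) = 0" "poly P (f2 z) = 0" using P(3) by (auto simp: split_0 simp flip: split_poly_at)
  then show "f1 z \<in> O\<^sub>K \<and> f2 z \<in> O\<^sub>K" using val_ring_integrally_closed P by blast
next
  assume h: "f1 z \<in> O\<^sub>K \<and> f2 z \<in> O\<^sub>K"
  have "z * z + emb (f1 z * f2 z) = emb (f1 z + f2 z) * z"
    by (rule split_eqI) (simp_all add: split_hom algebra_simps del: emb_hom)
  then have eq: "z * z = emb (f1 z + f2 z) * z - emb (f1 z * f2 z)" by (metis add_diff_cancel_right')
  show "z \<in> OL" by (rule quadratic_integral[OF eq]) (use h in auto)
qed

lemma nrm_split_iff: "nrm z \<noteq> 0 \<longleftrightarrow> f1 z \<noteq> 0 \<and> f2 z \<noteq> 0"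
  unfolding unit_iff_nrm[symmetric]
proof
  assume "\<exists>w. z * w = 1"
  then obtain w where w: "z * w = 1" ..
  then have "f1 z * f1 w = 1" "f2 z * f2 w = 1"
    using split_hom(3,4)[of z w] split_hom(5,6) by auto
  then show "f1 z \<noteq> 0 \<and> f2 z \<noteq> 0" by auto
next
  assume h: "f1 z \<noteq> 0 \<and> f2 z \<noteq> 0"
  obtain w where "f1 w = inverse (f1 z)" "f2 w = inverse (f2 z)" by (rule split_surj)
  then have "z * w = 1" using h by (intro split_eqI) (simp_all add: split_hom)
  then show "\<exists>w. z * w = 1" ..
qed

lemma image_mult_OL_split:
  assumes "f1 z \<noteq> 0" "f2 z \<noteq> 0"
  shows "(*) z ` OL = {w. val_ge v (f1 w) (v (f1 z)) \<and> val_ge v (f2 w) (v (f2 z))}"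
proof (intro set_eqI iffI)
  fix w assume "w \<in> (*) z ` OL"
  then obtain x where "f1 x \<in> O\<^sub>K" "f2 x \<in> O\<^sub>K" "w = z * x" using OL_split_iff by auto
  then show "w \<in> {w. val_ge v (f1 w) (v (f1 z)) \<and> val_ge v (f2 w) (v (f2 z))}"
    using image_mult_val_ring[OF assms(1)] image_mult_val_ring[OF assms(2)] by (auto simp: split_hom)
next
  fix w assume "w \<in> {w. val_ge v (f1 w) (v (f1 z)) \<and> val_ge v (f2 w) (v (f2 z))}"
  then have h: "f1 w / f1 z \<in> O\<^sub>K" "f2 w / f2 z \<in> O\<^sub>K"
    using assms by (auto intro!: val_ring_divide simp: val_ge_def)
  obtain x where x: "f1 x = f1 w / f1 z" "f2 x = f2 w / f2 z" by (rule split_surj)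
  have "w = z * x" using x assms by (intro split_eqI) (simp_all add: split_hom)
  moreover have "x \<in> OL" using x h by (simp add: OL_split_iff)
  ultimately show "w \<in> (*) z ` OL" by blast
qed

definition apart :: "int \<Rightarrow> 'l set" where
  "apart m = \<phi> -` (O\<^sub>K \<times> (\<lambda>x. p powi m * x) ` O\<^sub>K)"

lemma apart_eq: "apart m = {w. val_ge v (f1 w) 0 \<and> val_ge v (f2 w) m}"
proof -
  have "(\<lambda>x. p powi m * x) ` O\<^sub>K = {x. val_ge v x m}"
    by (subst image_mult_val_ring) (simp_all add: val_powi)
  then show ?thesis unfolding apart_def by (auto simp: val_ring_def mem_Times_iff)
qed

text \<open>The lattice z \<open>OL\<close> depends only on the valuations of the two components of
  z. Homothety makes the first one 0, so the class is labelled by their difference.\<close>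

lemma T_0_split: "T 0 = {cls (apart m) | m. True}"
proof (intro set_eqI iffI)
  fix x assume "x \<in> T 0"
  then obtain z where z: "nrm z \<noteq> 0" "x = cls ((*) z ` OL)" unfolding T_0_iff by blast
  then have nz: "f1 z \<noteq> 0" "f2 z \<noteq> 0" using nrm_split_iff by auto
  let ?c = "inverse (f1 z)" and ?m = "v (f2 z) - v (f1 z)"
  have c: "f1 (emb ?c * z) = 1" "f2 (emb ?c * z) = ?c * f2 z" using nz by (simp_all add: split_hom)
  have "(*) (emb ?c * z) ` OL = apart ?m"
    unfolding apart_eq by (subst image_mult_OL_split) (use c nz in \<open>auto simp: val_mult val_inverse\<close>)
  then have "x = cls (apart ?m)" using z(2) cls_mult_emb[of ?c z OL] nz by simp
  then show "x \<in> {cls (apart m) | m. True}" by blast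
next
  fix x assume "x \<in> {cls (apart m) | m. True}"
  then obtain m where m: "x = cls (apart m)" by blast
  obtain z where z: "f1 z = 1" "f2 z = p powi m" by (rule split_surj)
  then have nz: "f1 z \<noteq> 0" "f2 z \<noteq> 0" by auto
  have "(*) z ` OL = apart m"
    unfolding apart_eq image_mult_OL_split[OF nz] by (simp add: z val_powi)
  then show "x \<in> T 0" unfolding T_0_iff using m nz nrm_split_iff by metis
qed

text \<open>Testing the inclusions on the two idempotents and on (0, p^m) gives 0 <= v c <= d and 0
  <= v c + m <= d.\<close>

lemma apart_bound:
  assumes "c \<noteq> 0" "smul (p ^ d) ` OL \<subseteq> smul c ` apart m" "smul c ` apart m \<subseteq> OL"
  shows "m \<in> {- int d..int d}"
proof -
  obtain u1 where u1: "f1 u1 = 1" "f2 u1 = 0" by (rule split_surj)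
  obtain u2 where u2: "f1 u2 = 0" "f2 u2 = 1" by (rule split_surj)
  obtain w where w: "f1 w = 0" "f2 w = p powi m" by (rule split_surj)
  have "u1 \<in> apart m" "w \<in> apart m" unfolding apart_eq using u1 w by (auto simp: val_ge_def val_powi)
  then have "emb c * u1 \<in> OL" "emb c * w \<in> OL" using assms(3) by (auto simp: smul_eq)
  then have "c \<in> O\<^sub>K" "c * p powi m \<in> O\<^sub>K" unfolding OL_split_iff by (auto simp: split_hom u1 w)
  then have 1: "v c \<ge> 0" "v c + m \<ge> 0" using assms(1) by (auto simp: val_ring_iff val_mult val_powi)
  have "u1 \<in> OL" "u2 \<in> OL" unfolding OL_split_iff using u1 u2 by auto
  then have "smul (p ^ d) u1 \<in> smul c ` apart m" "smul (p ^ d) u2 \<in> smul c ` apart m"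
    using assms(2) by auto
  then obtain a b where a: "a \<in> apart m" "emb (p ^ d) * u1 = emb c * a"
    and b: "b \<in> apart m" "emb (p ^ d) * u2 = emb c * b" by (auto simp: smul_eq)
  have pa: "p ^ d = c * f1 a" using arg_cong[OF a(2), of f1] u1 by (simp add: split_hom del: emb_hom)
  have pb: "p ^ d = c * f2 b" using arg_cong[OF b(2), of f2] u2 by (simp add: split_hom del: emb_hom)
  have nz: "f1 a \<noteq> 0" "f2 b \<noteq> 0" using pa pb by auto
  have "int d = v c + v (f1 a)" "int d = v c + v (f2 b)"
    using val_p_power[of d, unfolded pa] val_p_power[of d, unfolded pb]
      val_mult[OF assms(1) nz(1)] val_mult[OF assms(1) nz(2)] by simp_all
  then have "int d \<ge> v c" "int d \<ge> v c + m" using a(1) b(1) nz by (auto simp: apart_eq val_ge_def)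
  then show ?thesis using 1 by auto
qed

end

end

locale quadratic_tree = monogenic_quadratic_algebra v smul p \<Delta>
  for v :: "'k::field_char_0 \<Rightarrow> int" and smul :: "'k \<Rightarrow> 'l::comm_ring_1 \<Rightarrow> 'l" and p \<Delta> +
  fixes \<pi> :: 'l and \<phi> :: "'l \<Rightarrow> 'k \<times> 'k"
  assumes ramified_uniformizer: "is_ramified v smul p \<Longrightarrow> is_uniformizer v smul \<pi>"
    and split_splitting: "is_split smul \<Longrightarrow> splitting smul \<phi>"
begin

text \<open>A ring that is not a field falls into the last branch of \<open>basin\<close>, and
  \<open>non_field_is_split\<close> guarantees that \<phi> is then a splitting. The explicit
  descriptions are returned as well because basin vertices are counted from them.\<close>

lemma basin_cases:
  obtains (unramified) "basin v smul p \<pi> \<phi> = T 0" "T 0 = {cls OL}"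
  | (ramified) "basin v smul p \<pi> \<phi> = T 0" "T 0 = {cls OL, cls ((*) \<pi> ` OL)}"
  | (split) "basin v smul p \<pi> \<phi> = T 0" "splitting smul \<phi>"
proof (cases "\<forall>x::'l. x \<noteq> 0 \<longrightarrow> (\<exists>y. x * y = 1)")
  case True
  show thesis
  proof (cases "is_uniformizer v smul (smul p 1)")
    case unif: True
    then have "T 0 = {cls OL}" by (rule T_0_unramified)
    moreover have "basin v smul p \<pi> \<phi> = {cls OL}"
      using unif True by (simp add: basin_def is_unramified_def Let_def)
    ultimately show thesis using unramified by simp
  next
    case nunif: False
    then have ram: "is_ramified v smul p" "\<not> is_unramified v smul p"
      using True by (auto simp: is_ramified_def is_unramified_def)
    then have "T 0 = {cls OL, cls ((*) \<pi> ` OL)}"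
      using T_0_ramified[OF nunif ramified_uniformizer] by blast
    moreover have "basin v smul p \<pi> \<phi> = {cls OL, cls ((*) \<pi> ` OL)}"
      using ram by (simp add: basin_def Let_def)
    ultimately show thesis using ramified by simp
  qed
next
  case False
  then have "\<not> is_ramified v smul p" "\<not> is_unramified v smul p"
    by (auto simp: is_ramified_def is_unramified_def)
  moreover have sp: "splitting smul \<phi>" using non_field_is_split[OF False] split_splitting by blast
  ultimately have "basin v smul p \<pi> \<phi> = T 0"
    unfolding T_0_split[OF sp] apart_def[OF sp] by (simp add: basin_def Let_def)
  then show thesis using split sp by blast
qed

lemma basin_eq: "basin v smul p \<pi> \<phi> = T 0"
  by (cases rule: basin_cases)

text \<open>If a \<open>ord k\<close> has index q^d in \<open>ord k\<close>, then p^d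
  \<open>OL\<close> <= a \<open>OL\<close> <= \<open>OL\<close>; so these are the basin vertices
  that can lie below endpoints of walks of length d.\<close>

definition near :: "nat \<Rightarrow> 'l set set set" where
  "near d = {y \<in> T 0. \<exists>\<Lambda>\<in>y. smul (p ^ d) ` OL \<subseteq> \<Lambda> \<and> \<Lambda> \<subseteq> OL}"

text \<open>A basin vertex in \<open>near d\<close> is \<open>[O\<^sub>K \<times> p\<^sup>m O\<^sub>K]\<close> with \<open>|m| \<le> d\<close> in the split case; otherwise
  the basin has at most two vertices. This linear growth gives convergence for all \<open>Re s > 0\<close>.\<close>

lemma near_bound: "finite (near d) \<and> card (near d) \<le> 2 * d + 2"
proof (cases rule: basin_cases)
  case unramified
  then have "near d \<subseteq> {cls OL}" by (auto simp: near_def)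
  then show ?thesis by (auto simp: subset_singleton_iff)
next
  case ramified
  let ?B = "{cls OL, cls ((*) \<pi> ` OL)}"
  have "near d \<subseteq> ?B" unfolding near_def ramified(2) by blast
  then have "finite (near d)" "card (near d) \<le> card ?B"
    by (rule finite_subset, simp) (rule card_mono[OF _ \<open>near d \<subseteq> ?B\<close>], simp)
  moreover have "card ?B \<le> 2" by (simp add: card_insert_if)
  ultimately show ?thesis by simp
next
  case split
  let ?B = "(\<lambda>m. cls (apart \<phi> m)) ` {- int d..int d}"
  have "near d \<subseteq> ?B"
  proof
    fix y assume "y \<in> near d"
    then obtain m \<Lambda> where "y = cls (apart \<phi> m)" "\<Lambda> \<in> y" "smul (p ^ d) ` OL \<subseteq> \<Lambda>" "\<Lambda> \<subseteq> OL"
      unfolding near_def T_0_split[OF split(2)] by blast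
    moreover then obtain c where "c \<noteq> 0" "\<Lambda> = smul c ` apart \<phi> m" by (auto simp: cls_mem_iff)
    ultimately have "m \<in> {- int d..int d}" "y = cls (apart \<phi> m)" using apart_bound[OF split(2)] by auto
    then show "y \<in> ?B" by blast
  qed
  then have "finite (near d)" "card (near d) \<le> card ?B"
    by (rule finite_subset, simp) (rule card_mono[OF _ \<open>near d \<subseteq> ?B\<close>], simp)
  moreover have "card ?B \<le> card {- int d..int d}" by (rule card_image_le) simp
  ultimately show ?thesis by simp
qed

end

subsection \<open>Comparison of the zeta functions\<close>

context monogenic_quadratic_algebra
begin

lemma ord_subset_OL: "ord k \<subseteq> OL"
proof
  fix z assume "z \<in> ord k"
  then show "z \<in> OL" unfolding ord_iff OL_iff by auto
qed

lemma scaled_OL_subset_ord: "(*) (emb (p ^ k)) ` OL \<subseteq> ord k"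
proof (rule image_subsetI)
  fix z assume "z \<in> OL"
  then have h: "cx z \<in> O\<^sub>K" "cy z \<in> O\<^sub>K" by (auto simp: OL_iff)
  have "cx (emb (p ^ k) * z) = p ^ k * cx z" "cy (emb (p ^ k) * z) = cy z * p ^ k"
    unfolding coord_mult coord_emb by (simp_all add: mult.commute)
  then show "emb (p ^ k) * z \<in> ord k" unfolding ord_iff using h by auto
qed

lemma image_mult_ord_subset_iff: "(*) a ` ord k \<subseteq> ord k \<longleftrightarrow> a \<in> ord k"
proof
  assume "(*) a ` ord k \<subseteq> ord k"
  then have "a * 1 \<in> ord k" using one_in_ord by blast
  then show "a \<in> ord k" by simp
qed (use ord_mult in blast)

section \<open>Principal ideals as endpoints of walks\<close>

lemma mult_ord_cls:
  assumes "lattice \<Lambda>" "nrm z \<noteq> 0" "cls \<Lambda> = cls ((*) z ` ord k)"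
  obtains a where "nrm a \<noteq> 0" "\<Lambda> = (*) a ` ord k"
proof -
  obtain c where c: "c \<noteq> 0" "\<Lambda> = smul c ` ((*) z ` ord k)" using cls_eqD[OF assms(3)[symmetric]] by blast
  then have "\<Lambda> = (*) (emb c * z) ` ord k" by (simp only: image_smul image_mult_image)
  moreover have "nrm (emb c * z) \<noteq> 0" using c assms(2) by simp
  ultimately show ?thesis using that by blast
qed

text \<open>Finite index forces two of the scalars p^j to agree modulo I, so I contains a nonzero
  scalar. If a had norm 0, its conjugate would annihilate this scalar and therefore vanish, and so
  would a. The converse is the existence of a finite chain of steps.\<close>

lemma fin_principal_ideals_ord:
  "fin_principal_ideals (ord k) = {(*) a ` ord k | a. a \<in> ord k \<and> nrm a \<noteq> 0}"
proof (intro set_eqI iffI)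
  fix I assume "I \<in> fin_principal_ideals (ord k)"
  then obtain a where a: "a \<in> ord k" "I = (*) a ` ord k" "finite (add_cosets (ord k) I)"
    unfolding fin_principal_ideals_def by auto
  have "nrm a \<noteq> 0"
  proof
    assume "nrm a = 0"
    then have cj0: "cj a * a = 0" using mult_cj[of a] by (simp add: mult.commute)
    let ?C = "\<lambda>x. {y \<in> ord k. x - y \<in> I}"
    have pk: "emb (p ^ j) \<in> ord k" for j
      unfolding ord_iff coord_emb by (auto intro: bexI[of _ 0])
    have "range (\<lambda>j. ?C (emb (p ^ j))) \<subseteq> add_cosets (ord k) I"
      unfolding add_cosets_eq_image using pk by blast
    then have "finite (range (\<lambda>j. ?C (emb (p ^ j))))" using a(3) finite_subset by blast
    then have "\<not> inj (\<lambda>j. ?C (emb (p ^ j)))" using finite_imageD infinite_UNIV_nat by blast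
    then obtain i j where ij: "i \<noteq> j" "?C (emb (p ^ i)) = ?C (emb (p ^ j))" unfolding inj_def by blast
    have "0 \<in> ord k" using add_subgroupD(1)[OF lattice_add_subgroup[OF lattice_ord]] .
    then have "0 \<in> I" unfolding a(2) by (rule rev_image_eqI) simp
    then have "emb (p ^ i) \<in> ?C (emb (p ^ i))" using pk by simp
    then have "emb (p ^ j) - emb (p ^ i) \<in> I" unfolding ij(2) by blast
    then obtain x where x: "emb (p ^ j - p ^ i) = a * x" unfolding a(2) by auto
    have ne: "p ^ j - p ^ i \<noteq> 0" using ij(1) by (metis right_minus_eq val_p_power of_nat_eq_iff)
    have "emb (p ^ j - p ^ i) * cj a = 0" unfolding x using cj0
      by (metis mult.assoc mult.commute mult_zero_right)
    then have "cj a = 0" using emb_cancel[OF ne, of "cj a" 0] by simp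
    moreover have z0: "cx 0 = 0" "cy 0 = 0" using coord_emb[of 0] by simp_all
    ultimately have "cy a = 0" using coord_cj(2)[of a] by simp
    moreover from this have "cx a = 0" using coord_cj(1)[of a] z0 \<open>cj a = 0\<close> by simp
    ultimately have "a = 0" by (intro coord_ext) (simp_all add: z0)
    then show False using x ne emb_eq_0_iff[of "p ^ j - p ^ i"] by simp
  qed
  then show "I \<in> {(*) a ` ord k | a. a \<in> ord k \<and> nrm a \<noteq> 0}" using a by blast
next
  fix I assume "I \<in> {(*) a ` ord k | a. a \<in> ord k \<and> nrm a \<noteq> 0}"
  then obtain a where a: "a \<in> ord k" "nrm a \<noteq> 0" "I = (*) a ` ord k" by blast
  have "\<exists>d. (ord k, I) \<in> step ^^ d"
    unfolding a(3) by (rule steps_exist[OF lattice_ord lattice_mult_ord[OF a(2)]])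
      (simp add: image_mult_ord_subset_iff a)
  then obtain d where "(ord k, I) \<in> step ^^ d" ..
  from steps_index(3)[OF this lattice_ord] show "I \<in> fin_principal_ideals (ord k)"
    unfolding fin_principal_ideals_def using a by blast
qed

text \<open>Grading by chains rather than by the index q^d gives direct access to the lifting of
  walks; the two agree by \<open>ideals_index\<close> and \<open>steps_exist\<close>.\<close>

definition ideals :: "nat \<Rightarrow> nat \<Rightarrow> 'l set set" where
  "ideals k d = {I \<in> fin_principal_ideals (ord k). (ord k, I) \<in> step ^^ d}"

lemma ideals_index: "I \<in> ideals k d \<Longrightarrow> add_index (ord k) I = q ^ d"
  unfolding ideals_def using steps_index(4)[OF _ lattice_ord] by blast

lemma fin_principal_ideals_graded: "bij_betw snd (Sigma UNIV (ideals k)) (fin_principal_ideals (ord k))"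
  unfolding bij_betw_def
proof
  show "inj_on snd (Sigma UNIV (ideals k))"
  proof (rule inj_onI)
    fix x y assume "x \<in> Sigma UNIV (ideals k)" "y \<in> Sigma UNIV (ideals k)" "snd x = snd y"
    moreover then have "q ^ fst x = q ^ fst y"
      using ideals_index[of "snd x" k "fst x"] ideals_index[of "snd y" k "fst y"] by auto
    then have "fst x = fst y" using residue_card_ge_2 by simp
    ultimately show "x = y" by (simp add: prod_eq_iff)
  qed
  have "\<exists>d. I \<in> ideals k d" if I: "I \<in> fin_principal_ideals (ord k)" for I
  proof -
    obtain a where a: "a \<in> ord k" "nrm a \<noteq> 0" "I = (*) a ` ord k"
      using I unfolding fin_principal_ideals_ord by blast
    have "\<exists>d. (ord k, I) \<in> step ^^ d"
      unfolding a(3) by (rule steps_exist[OF lattice_ord lattice_mult_ord[OF a(2)]])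
        (simp add: image_mult_ord_subset_iff a)
    then show ?thesis using I unfolding ideals_def by blast
  qed
  then show "snd ` Sigma UNIV (ideals k) = fin_principal_ideals (ord k)"
    by (force simp: ideals_def image_iff)
qed

abbreviation "reach k d \<equiv> reach_set V E (T 0) (cls (ord k)) d"

text \<open>The lifted endpoint itself, not only its class, is a multiple of \<open>ord k\<close>,
  because the homothety factor can be absorbed into a.\<close>

lemma reach_iff: "x \<in> reach k d \<longleftrightarrow>
  (\<exists>a. nrm a \<noteq> 0 \<and> (ord k, (*) a ` ord k) \<in> step ^^ d \<and> x = cls ((*) a ` ord k))"
proof
  assume "x \<in> reach k d"
  then have x: "x \<in> layer V E (T 0) k" "(cls (ord k), x) \<in> E ^^ d"
    by (auto simp: reach_set_def height_ord)
  then obtain \<Lambda> where L: "(ord k, \<Lambda>) \<in> step ^^ d" "x = cls \<Lambda>" using walk_iff[OF lattice_ord] by blast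
  obtain z where z: "nrm z \<noteq> 0" "x = cls ((*) z ` ord k)" using x(1) unfolding layer_T_iff by blast
  obtain a where "nrm a \<noteq> 0" "\<Lambda> = (*) a ` ord k"
    using mult_ord_cls[OF steps_index(1)[OF L(1) lattice_ord] z(1)] L(2) z(2) by metis
  then show "\<exists>a. nrm a \<noteq> 0 \<and> (ord k, (*) a ` ord k) \<in> step ^^ d \<and> x = cls ((*) a ` ord k)" using L by blast
next
  assume "\<exists>a. nrm a \<noteq> 0 \<and> (ord k, (*) a ` ord k) \<in> step ^^ d \<and> x = cls ((*) a ` ord k)"
  then obtain a where a: "nrm a \<noteq> 0" "(ord k, (*) a ` ord k) \<in> step ^^ d" "x = cls ((*) a ` ord k)" by blast
  have "x \<in> layer V E (T 0) k" unfolding layer_T_iff using a by blast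
  moreover have "(cls (ord k), x) \<in> E ^^ d" unfolding walk_iff[OF lattice_ord] using a by blast
  ultimately show "x \<in> reach k d" by (simp add: reach_set_def height_ord)
qed

text \<open>Homothetic ideals of equal index coincide. For surjectivity, a chain descending from
  \<open>ord k\<close> to a \<open>ord k\<close> already forces a to lie in \<open>ord k\<close>, so
  the endpoint is an ideal.\<close>

lemma ideals_bij_reach: "bij_betw cls (ideals k d) (reach k d)"
  unfolding bij_betw_def
proof
  show "inj_on cls (ideals k d)"
  proof (rule inj_onI)
    fix I J assume "I \<in> ideals k d" "J \<in> ideals k d" "cls I = cls J"
    then show "I = J" using steps_class_inj[OF lattice_ord] unfolding ideals_def by blast
  qed
  have "ideals k d = {(*) a ` ord k | a. nrm a \<noteq> 0 \<and> (ord k, (*) a ` ord k) \<in> step ^^ d}" (is "_ = ?R")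
  proof
    show "ideals k d \<subseteq> ?R" unfolding ideals_def fin_principal_ideals_ord by blast
    show "?R \<subseteq> ideals k d"
    proof
      fix I assume "I \<in> ?R"
      then obtain a where a: "nrm a \<noteq> 0" "(ord k, I) \<in> step ^^ d" "I = (*) a ` ord k" by blast
      then have "a \<in> ord k" using steps_index(2)[OF a(2) lattice_ord] image_mult_ord_subset_iff by simp
      then show "I \<in> ideals k d" unfolding ideals_def fin_principal_ideals_ord using a by blast
    qed
  qed
  then have "x \<in> cls ` ideals k d \<longleftrightarrow> x \<in> reach k d" for x
    unfolding reach_iff by (simp only:) blast
  then show "cls ` ideals k d = reach k d" by blast
qed

end

section \<open>Growth of the counts and convergence\<close>

context quadratic_tree
begin

text \<open>Send the vertex [a \<open>ord k\<close>] to the basin vertex [a \<open>OL\<close>].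
  There are at most 2d + 2 images, and a fibre consists of classes of lattices between p^k M and M
  for a fixed lattice M. That index is q^(2k), whence a factor independent of d.\<close>

lemma reach_bound:
  "finite (reach k d) \<and> card (reach k d) \<le> (2 * d + 2) * 2 ^ (q ^ (2 * k))"
proof -
  \<comment> \<open>One representative is fixed for each basin vertex, so that \<open>nb y\<close>
    does not depend on the element a that led to y.\<close>
  define rep where "rep y = (SOME \<Lambda>. \<Lambda> \<in> y)" for y :: "'l set set"
  define nb where "nb y = cls ` {C. add_subgroup C \<and> smul (p ^ k) ` rep y \<subseteq> C \<and> C \<subseteq> rep y}" for y
  have nb: "finite (nb y) \<and> card (nb y) \<le> 2 ^ (q ^ (2 * k))" if y: "y \<in> near d" for y
  proof -
    obtain \<Lambda> where "lattice \<Lambda>" "y = cls \<Lambda>" using y T_subset_V[of 0] vertex_iff[of y]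
      unfolding near_def by blast
    then have "rep y \<in> cls \<Lambda>" unfolding rep_def using cls_self someI by metis
    then have L: "lattice (rep y)" using cls_mem_lattice \<open>lattice \<Lambda>\<close> by blast
    note st = steps_scale[OF L, of k]
    note idx = steps_index[OF st L]
    note bd = subgroups_between_bound[OF lattice_add_subgroup[OF L] lattice_add_subgroup[OF idx(1)] idx(2,3)]
    have "card (nb y) \<le> card {C. add_subgroup C \<and> smul (p ^ k) ` rep y \<subseteq> C \<and> C \<subseteq> rep y}"
      unfolding nb_def using bd(1) by (rule card_image_le)
    then show ?thesis using bd idx(4) unfolding nb_def by auto
  qed
  have sub: "reach k d \<subseteq> (\<Union>y\<in>near d. nb y)"
  proof
    fix x assume "x \<in> reach k d"
    then obtain a where a: "nrm a \<noteq> 0" "(ord k, (*) a ` ord k) \<in> step ^^ d" "x = cls ((*) a ` ord k)"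
      unfolding reach_iff by blast
    note idx = steps_index[OF a(2) lattice_ord]
    have aO: "a \<in> OL" using idx(2) image_mult_ord_subset_iff ord_subset_OL by blast
    \<comment> \<open>The cofactor b with p^d = a b lies in \<open>ord k\<close>, which gives p^d
      \<open>OL\<close> <= a \<open>OL\<close>.\<close>
    have "smul (p ^ d) 1 \<in> (*) a ` ord k" using idx(5) one_in_ord by blast
    then obtain b where b: "b \<in> ord k" "emb (p ^ d) = a * b" by (auto simp: smul_eq)
    define y where "y = cls ((*) a ` OL)"
    have "smul (p ^ d) ` OL \<subseteq> (*) a ` OL"
    proof (rule image_subsetI)
      fix z assume "z \<in> OL"
      then have "b * z \<in> OL" using b(1) ord_subset_OL OL_mult by blast
      moreover have "smul (p ^ d) z = a * (b * z)"
        unfolding smul_eq[of "p ^ d"] b(2) by (rule mult.assoc)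
      ultimately show "smul (p ^ d) z \<in> (*) a ` OL" by simp
    qed
    moreover have "(*) a ` OL \<subseteq> OL" using OL_mult aO by blast
    moreover have "y \<in> T 0" unfolding y_def T_0_iff using a(1) by blast
    ultimately have y: "y \<in> near d" unfolding near_def using cls_self[of "(*) a ` OL"] y_def by auto
    have "rep y \<in> y" unfolding rep_def y_def
      using cls_self[of "(*) a ` OL"] by (rule someI[of "\<lambda>M. M \<in> cls ((*) a ` OL)"])
    then obtain c where c: "c \<noteq> 0" "rep y = smul c ` ((*) a ` OL)" unfolding y_def cls_mem_iff by blast
    let ?I = "smul c ` ((*) a ` ord k)"
    have "?I \<subseteq> rep y" unfolding c(2) using ord_subset_OL by (intro image_mono)
    moreover have "smul (p ^ k) ` rep y = smul c ` ((*) a ` ((*) (emb (p ^ k)) ` OL))"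
      unfolding c(2) image_smul image_mult_image by (simp only: ac_simps)
    then have "smul (p ^ k) ` rep y \<subseteq> ?I" using scaled_OL_subset_ord by (simp only: image_mono)
    moreover have "lattice ?I" using lattice_smul[OF idx(1) c(1)] .
    moreover have "x = cls ?I" using a(3) cls_smul[OF c(1)] by simp
    ultimately have "x \<in> nb y" unfolding nb_def using lattice_add_subgroup[of ?I] by blast
    then show "x \<in> (\<Union>y\<in>near d. nb y)" using y by blast
  qed
  have fin: "finite (\<Union>y\<in>near d. nb y)" using near_bound nb by blast
  have "card (reach k d) \<le> card (\<Union>y\<in>near d. nb y)" using card_mono[OF fin sub] .
  also have "\<dots> \<le> (\<Sum>y\<in>near d. card (nb y))" using near_bound by (intro card_UN_le) blast
  also have "\<dots> \<le> card (near d) * 2 ^ (q ^ (2 * k))"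
    using sum_bounded_above[of "near d" "\<lambda>y. card (nb y)" "2 ^ (q ^ (2 * k))"] nb by simp
  also have "\<dots> \<le> (2 * d + 2) * 2 ^ (q ^ (2 * k))" using near_bound by (intro mult_right_mono) auto
  finally show ?thesis using finite_subset[OF sub fin] by blast
qed

text \<open>Linear growth gives absolute convergence for |X| < 1, and this permits regrouping the
  unordered sum over ideals into finite sums over the grades.\<close>

lemma zeta_equality:
  fixes s :: complex
  assumes s: "Re s > 0"
  defines "X \<equiv> of_nat q powr (- s)"
  shows "zeta_P_term (ord k) s summable_on fin_principal_ideals (ord k)"
    "summable (zeta_B_term V E (T 0) (cls (ord k)) X)"
    "zeta_P (ord k) s = zeta_B V E (T 0) (cls (ord k)) X"
proof -
  have q: "real q > 1" using residue_card_ge_2 by simp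
  \<comment> \<open>The complex power is unfolded through the real logarithm of q^d, since power
    laws for the principal branch need a positive real base.\<close>
  have pw: "zeta_P_term (ord k) s I = X ^ d" if "I \<in> ideals k d" for I d
  proof -
    have "complex_of_nat (q ^ d) = complex_of_real (real q ^ d)" by simp
    then have "complex_of_nat (q ^ d) powr s = exp (s * complex_of_real (ln (real q ^ d)))"
      using q by (simp add: powr_def Ln_of_real del: of_nat_power of_real_power)
    also have "\<dots> = exp (of_nat d * (s * complex_of_real (ln (real q))))"
      using q by (simp add: ln_realpow algebra_simps)
    also have "\<dots> = exp (s * complex_of_real (ln (real q))) ^ d" by (rule exp_of_nat_mult)
    finally have "1 / complex_of_nat (q ^ d) powr s = inverse (exp (s * complex_of_real (ln (real q)))) ^ d"
      by (simp add: divide_inverse power_inverse)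
    also have "inverse (exp (s * complex_of_real (ln (real q)))) = X"
      unfolding X_def using q Ln_of_real[of "real q"] by (simp add: powr_def exp_minus)
    finally show ?thesis unfolding zeta_P_term_def ideals_index[OF that] .
  qed
  have "norm X = real q powr (- Re s)"
    unfolding X_def by (subst norm_powr_real_powr) auto
  also have "\<dots> < 1" using q s by (simp add: powr_less_one)
  finally have X: "norm X < 1" .
  have card: "card (ideals k d) = card (reach k d)" "finite (ideals k d)" for d
    using bij_betw_same_card[OF ideals_bij_reach] bij_betw_finite[OF ideals_bij_reach] reach_bound by auto
  define C where "C = (2 * 2 ^ (q ^ (2 * k)) :: real)"
  have bound: "real (card (ideals k d)) \<le> C * real (Suc d)" for d
  proof -
    have "real (card (ideals k d)) \<le> real ((2 * d + 2) * 2 ^ (q ^ (2 * k)))"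
      unfolding card of_nat_le_iff using reach_bound by blast
    then show ?thesis by (simp add: C_def algebra_simps)
  qed
  \<comment> \<open>The majorant is a constant times the derivative of the geometric series.\<close>
  have geo: "summable (\<lambda>d. C * (real (Suc d) * norm X ^ d))"
    using geometric_deriv_sums[of "norm X"] X by (intro summable_mult) (auto simp: sums_iff)
  have norm_sum: "summable (\<lambda>d. real (card (ideals k d)) * norm X ^ d)"
  proof (rule summable_comparison_test'[OF geo])
    fix d
    show "norm (real (card (ideals k d)) * norm X ^ d) \<le> C * (real (Suc d) * norm X ^ d)"
      using mult_right_mono[OF bound, of "norm X ^ d" d] by (simp add: mult.assoc del: of_nat_Suc)
  qed
  have zB: "zeta_B_term V E (T 0) (cls (ord k)) X = (\<lambda>d. of_nat (card (ideals k d)) * X ^ d)"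
    by (simp add: fun_eq_iff zeta_B_term_def reach_count_def card)
  have abs_B: "summable (\<lambda>d. norm (zeta_B_term V E (T 0) (cls (ord k)) X d))"
    unfolding zB using norm_sum by (simp add: norm_mult norm_power)
  then show "summable (zeta_B_term V E (T 0) (cls (ord k)) X)" by (rule summable_norm_cancel)
  define g where "g = (\<lambda>(d::nat, I). zeta_P_term (ord k) s I)"
  have "(\<lambda>x. norm (g x)) summable_on Sigma UNIV (ideals k)"
    unfolding Infinite_Sum.abs_summable_on_Sigma_iff
  proof
    show "\<forall>d\<in>UNIV. (\<lambda>I. norm (g (d, I))) summable_on ideals k d" using card by simp
    have "(\<Sum>\<^sub>\<infinity>I\<in>ideals k d. norm (g (d, I))) = real (card (ideals k d)) * norm X ^ d" for d
      using card by (simp add: g_def pw norm_power)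
    then show "(\<lambda>d. norm (\<Sum>\<^sub>\<infinity>I\<in>ideals k d. norm (g (d, I)))) summable_on UNIV"
      using norm_sum by (simp add: norm_mult norm_power norm_summable_imp_summable_on)
  qed
  then have g: "g summable_on Sigma UNIV (ideals k)" by (rule abs_summable_summable)
  have g_snd: "g = (\<lambda>x. zeta_P_term (ord k) s (snd x))" by (auto simp: g_def)
  show "zeta_P_term (ord k) s summable_on fin_principal_ideals (ord k)"
    using g unfolding g_snd summable_on_reindex_bij_betw[OF fin_principal_ideals_graded] .
  have "zeta_P (ord k) s = infsum g (Sigma UNIV (ideals k))"
    unfolding zeta_P_def g_snd infsum_reindex_bij_betw[OF fin_principal_ideals_graded] ..
  also have "\<dots> = (\<Sum>\<^sub>\<infinity>d. \<Sum>\<^sub>\<infinity>I\<in>ideals k d. g (d, I))" using infsum_Sigma_banach[OF g] by simp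
  also have "\<dots> = (\<Sum>\<^sub>\<infinity>d. zeta_B_term V E (T 0) (cls (ord k)) X d)"
    unfolding zB using card by (intro infsum_cong) (simp add: g_def pw)
  also have "\<dots> = zeta_B V E (T 0) (cls (ord k)) X"
    unfolding zeta_B_def
    using norm_summable_imp_has_sum[OF abs_B summable_sums[OF summable_norm_cancel[OF abs_B]]]
    by (rule infsumI)
  finally show "zeta_P (ord k) s = zeta_B V E (T 0) (cls (ord k)) X" .
qed

end

text \<open>Infinite sums and \<open>card\<close> have a value even for divergent series and
  infinite sets; therefore convergence and finiteness are asserted along with the equality.\<close>

theorem theorem6p12:
  fixes v :: "'k::field_char_0 \<Rightarrow> int"
    and smul :: "'k \<Rightarrow> 'l::comm_ring_1 \<Rightarrow> 'l"
    and p :: 'k and \<Delta> \<pi> :: 'l and \<phi> :: "'l \<Rightarrow> 'k \<times> 'k"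
    and n :: nat and s :: complex
  assumes "nonarch_local_field v"
    and "val_uniformizer v p"
    and "reduced_quadratic_algebra smul"
    and "\<Delta> \<in> integral_closure v smul"
    and "integral_closure v smul = adjoin v smul \<Delta>"
    and "is_ramified v smul p \<Longrightarrow> is_uniformizer v smul \<pi>"
    and "is_split smul \<Longrightarrow> splitting smul \<phi>"
    and "Re s > 0"
  shows "zeta_P_term (quad_order v smul p \<Delta> n) s
           summable_on fin_principal_ideals (quad_order v smul p \<Delta> n) \<and>
         (\<forall>d. finite (reach_set (bt_vertices v smul) (bt_edges v smul p) (basin v smul p \<pi> \<phi>)
           (homothety_class smul (quad_order v smul p \<Delta> n)) d)) \<and>
         summable (zeta_B_term (bt_vertices v smul) (bt_edges v smul p) (basin v smul p \<pi> \<phi>)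
           (homothety_class smul (quad_order v smul p \<Delta> n))
           (of_nat (residue_card v) powr (- s))) \<and>
         zeta_P (quad_order v smul p \<Delta> n) s =
           zeta_B (bt_vertices v smul) (bt_edges v smul p) (basin v smul p \<pi> \<phi>)
             (homothety_class smul (quad_order v smul p \<Delta> n))
             (of_nat (residue_card v) powr (- s))"
proof -
  interpret quadratic_tree v smul p \<Delta> \<pi> \<phi>
    using assms(1-7)
    by (simp add: quadratic_tree_def quadratic_tree_axioms_def monogenic_quadratic_algebra_def
        monogenic_quadratic_algebra_axioms_def local_quadratic_algebra_def
        local_quadratic_algebra_axioms_def)
  show ?thesis
    unfolding basin_eq using zeta_equality[OF assms(8)] reach_bound by simp
qed

end
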